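(* Call a complete totally geodesic subset of $\mathbb{H}_{\mathbb{C}}^2$ trivial if it is the empty set, a single point, a geodesic, or all of $\mathbb{H}_{\mathbb{C}}^2$. Then the non-trivial complete totally geodesic subsets of $\mathbb{H}_{\mathbb{C}}^2$ are precisely the complex geodesics and the real planes. In particular, every complete totally geodesic subset $C\subset\mathbb{H}_{\mathbb{C}}^2$ is either $\varnothing$, a point, a geodesic, a complex geodesic, a real plane, or $\mathbb{H}_{\mathbb{C}}^2$.
   Context: Let $\mathbb{C}^3$ be endowed with the Hermitian form $\langle x,y\rangle=-x_0\overline{y_0}+x_1\overline{y_1}+x_2\overline{y_2}$. The complex hyperbolic plane is $\mathbb{H}_{\mathbb{C}}^2=\{[p]\in\mathbb{P}_{\mathbb{C}}(\mathbb{C}^3):\langle p,p\rangle<0\}$, with the topology induced from the projective space. For a real-linear subspace $W\subset\mathbb{C}^3$, $\mathbb{P}_{\mathbb{C}}(W)$ denotes the image of $W\setminus\{0\}$ in $\mathbb{P}_{\mathbb{C}}(\mathbb{C}^3)$. A geodesic is a set $\mathbb{H}_{\mathbb{C}}^2\cap\mathbb{P}_{\mathbb{C}}(W)$ where $W\subset\mathbb{C}^3$ is a real two-dimensional subspace such that $\langle\cdot,\cdot\rangle|_{W\times W}$ is real-valued with signature $-+$. Two distinct points $[p],[q]\in\mathbb{H}_{\mathbb{C}}^2$ lie in a unique geodesic, given by $W=\mathbb{R}p\oplus\mathbb{R}\langle p,q\rangle q$. A complex geodesic is a set $\mathbb{H}_{\mathbb{C}}^2\cap\mathbb{P}_{\mathbb{C}}(W)$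 where $W\subset\mathbb{C}^3$ is a complex two-dimensional subspace on which the Hermitian form has signature $-+$. A real plane is a set $\mathbb{H}_{\mathbb{C}}^2\cap\mathbb{P}_{\mathbb{C}}(W)$ where $W\subset\mathbb{C}^3$ is a real three-dimensional subspace such that $\langle\cdot,\cdot\rangle|_{W\times W}$ is real-valued with signature $-++$. A subset $C\subset\mathbb{H}_{\mathbb{C}}^2$ (not assumed to be a submanifold) is called complete totally geodesic if it is closed in $\mathbb{H}_{\mathbb{C}}^2$ and, for any two distinct points of $C$, the whole geodesic determined by these points (not only the segment joining them) is contained in $C$. *)

theory Defs
  imports "HOL-Analysis.Analysis"
begin

text \<open>
  Vectors of \<open>\<complex>\<^sup>3\<close> are elements of \<^typ>\<open>complex ^ 3\<close>. The index type \<^typ>\<open>3\<close> consists of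
  \<open>0, 1, 2\<close> (library lemmas such as \<open>forall_3\<close> write \<open>3\<close> for the index \<open>0\<close>), so
  coordinates are numbered \<open>x\<^sub>0, x\<^sub>1, x\<^sub>2\<close> as usual. The constants \<open>subspace\<close>, \<open>dim\<close>, \<open>span\<close>,
  \<open>independent\<close> refer to the real vector space structure, and their \<open>vec.\<close> counterparts
  to the complex one.
\<close>

definition herm :: "complex ^ 3 \<Rightarrow> complex ^ 3 \<Rightarrow> complex" where
  "herm x y = - (x $ 0) * cnj (y $ 0) + x $ 1 * cnj (y $ 1) + x $ 2 * cnj (y $ 2)"

definition proj_rel :: "complex ^ 3 \<Rightarrow> complex ^ 3 \<Rightarrow> bool" where
  "proj_rel p q \<longleftrightarrow> p \<noteq> 0 \<and> q \<noteq> 0 \<and> (\<exists>c. q = c *s p)"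

lemma part_equivp_proj_rel: "part_equivp proj_rel"
proof (rule part_equivpI)
  have "proj_rel (axis 0 1) (axis 0 1)"
    unfolding proj_rel_def by (metis axis_eq_0_iff vector_smult_lid zero_neq_one)
  then show "\<exists>x. proj_rel x x" ..
  show "symp proj_rel"
  proof (rule sympI)
    fix p q assume "proj_rel p q"
    then obtain c where c: "p \<noteq> 0" "q \<noteq> 0" "q = c *s p"
      unfolding proj_rel_def by blast
    then have "c \<noteq> 0" by auto
    then have "p = inverse c *s q"
      using c by (simp add: vector_smult_assoc)
    then show "proj_rel q p"
      using c unfolding proj_rel_def by blast
  qed
  show "transp proj_rel"
    by (rule transpI) (auto simp: proj_rel_def vector_smult_assoc)
qed

text \<open>The complex projective plane; \<open>cp2_of p\<close> is the point \<open>[p]\<close>, meaningful for \<open>p \<noteq> 0\<close>.\<close>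

quotient_type cp2 = "complex ^ 3" / partial: proj_rel
  morphisms rep_cp2 cp2_of
  by (rule part_equivp_proj_rel)

text \<open>The quotient topology induced by the projection from \<open>\<complex>\<^sup>3 - {0}\<close>, which is open in \<open>\<complex>\<^sup>3\<close>.\<close>

instantiation cp2 :: topological_space
begin

definition open_cp2 :: "cp2 set \<Rightarrow> bool" where
  "open_cp2 U \<longleftrightarrow> open {p. p \<noteq> 0 \<and> cp2_of p \<in> U}"

instance
proof
  have "{p :: complex ^ 3. p \<noteq> 0 \<and> cp2_of p \<in> UNIV} = - {0}" by auto
  then show "open (UNIV :: cp2 set)"
    unfolding open_cp2_def by (simp add: open_Compl)
next
  fix S T :: "cp2 set" assume "open S" "open T"
  moreover have "{p. p \<noteq> 0 \<and> cp2_of p \<in> S \<inter> T} =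
      {p. p \<noteq> 0 \<and> cp2_of p \<in> S} \<inter> {p. p \<noteq> 0 \<and> cp2_of p \<in> T}" by auto
  ultimately show "open (S \<inter> T)"
    unfolding open_cp2_def by (simp only: open_Int)
next
  fix K :: "cp2 set set" assume "\<forall>S\<in>K. open S"
  moreover have "{p. p \<noteq> 0 \<and> cp2_of p \<in> \<Union>K} =
      (\<Union>S\<in>K. {p. p \<noteq> 0 \<and> cp2_of p \<in> S})" by auto
  ultimately show "open (\<Union>K)"
    unfolding open_cp2_def by (simp only: open_UN)
qed

end

definition projectivize :: "(complex ^ 3) set \<Rightarrow> cp2 set" where
  "projectivize W = cp2_of ` (W - {0})"

text \<open>\<open>herm p p\<close> is always real, so taking the real part only changes its type.\<close>

definition hyp_plane :: "cp2 set" where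
  "hyp_plane = {cp2_of p | p. Re (herm p p) < 0}"

definition real_valued_on :: "(complex ^ 3) set \<Rightarrow> bool" where
  "real_valued_on W \<longleftrightarrow> (\<forall>x\<in>W. \<forall>y\<in>W. herm x y \<in> \<real>)"

definition herm_orthogonal :: "(complex ^ 3) set \<Rightarrow> (complex ^ 3) set \<Rightarrow> bool" where
  "herm_orthogonal N P \<longleftrightarrow>
     finite N \<and> finite P \<and>
     pairwise (\<lambda>x y. herm x y = 0) (N \<union> P) \<and>
     (\<forall>x\<in>N. Re (herm x x) < 0) \<and> (\<forall>x\<in>P. Re (herm x x) > 0)"

text \<open>
  The form restricted to \<open>W\<close> has signature with \<open>m\<close> minus signs, \<open>n\<close> plus signs and no zeros:
  \<open>W\<close> has an orthogonal basis, over the reals or over the complex numbers respectively, made of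
  \<open>m\<close> negative and \<open>n\<close> positive vectors. The real version is only used when the form is
  real-valued on \<open>W\<close>.
\<close>

definition real_signature :: "(complex ^ 3) set \<Rightarrow> nat \<Rightarrow> nat \<Rightarrow> bool" where
  "real_signature W m n \<longleftrightarrow>
     (\<exists>N P. herm_orthogonal N P \<and> card N = m \<and> card P = n \<and>
            independent (N \<union> P) \<and> span (N \<union> P) = W)"

definition complex_signature :: "(complex ^ 3) set \<Rightarrow> nat \<Rightarrow> nat \<Rightarrow> bool" where
  "complex_signature W m n \<longleftrightarrow>
     (\<exists>N P. herm_orthogonal N P \<and> card N = m \<and> card P = n \<and>
            vec.independent (N \<union> P) \<and> vec.span (N \<union> P) = W)"

definition is_geodesic :: "cp2 set \<Rightarrow> bool" where
  "is_geodesic G \<longleftrightarrow>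
     (\<exists>W. subspace W \<and> dim W = 2 \<and> real_valued_on W \<and> real_signature W 1 1 \<and>
          G = hyp_plane \<inter> projectivize W)"

definition is_complex_geodesic :: "cp2 set \<Rightarrow> bool" where
  "is_complex_geodesic G \<longleftrightarrow>
     (\<exists>W. vec.subspace W \<and> vec.dim W = 2 \<and> complex_signature W 1 1 \<and>
          G = hyp_plane \<inter> projectivize W)"

definition is_real_plane :: "cp2 set \<Rightarrow> bool" where
  "is_real_plane R \<longleftrightarrow>
     (\<exists>W. subspace W \<and> dim W = 3 \<and> real_valued_on W \<and> real_signature W 1 2 \<and>
          R = hyp_plane \<inter> projectivize W)"

text \<open>
  Two distinct points \<open>[p]\<close>, \<open>[q]\<close> of \<open>hyp_plane\<close> lie in exactly one geodesic, the one given by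
  \<open>W = \<real>p \<oplus> \<real>\<langle>p,q\<rangle>q\<close>; hence the quantifier over \<open>G\<close> below ranges over that single geodesic.
\<close>

definition complete_totally_geodesic :: "cp2 set \<Rightarrow> bool" where
  "complete_totally_geodesic C \<longleftrightarrow>
     C \<subseteq> hyp_plane \<and> closedin (top_of_set hyp_plane) C \<and>
     (\<forall>x\<in>C. \<forall>y\<in>C. x \<noteq> y \<longrightarrow> (\<forall>G. is_geodesic G \<and> x \<in> G \<and> y \<in> G \<longrightarrow> G \<subseteq> C))"

definition trivial_set :: "cp2 set \<Rightarrow> bool" where
  "trivial_set C \<longleftrightarrow>
     C = {} \<or> (\<exists>x\<in>hyp_plane. C = {x}) \<or> is_geodesic C \<or> C = hyp_plane"

end

theory Submission
  imports Defs
begin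

text \<open>
  Let \<open>C\<close> be complete totally geodesic and \<open>[p] \<in> C\<close> with \<open>\<langle>p,p\<rangle> = -1\<close>. Since geodesics through \<open>[p]\<close> are
  straight in the chart \<open>v \<mapsto> [p + v]\<close>, \<open>v \<in> p\<^sup>\<bottom>\<close>, the set \<open>C\<close> is there a real cone \<open>T\<close>, closed because \<open>C\<close>
  is. For small \<open>u, v \<in> T\<close> and \<open>k = 1 - \<langle>u,v\<rangle>\<close>, the geodesic joining \<open>[p + u]\<close> and \<open>[p + v]\<close> yields
  \<open>(1 + t \<cdot> cnj k) (u + t k v) \<in> T\<close> for \<open>t \<ge> 0\<close>. Rescaling \<open>u, v\<close> to \<open>0\<close> in this formula gives \<open>u + v \<in> T\<close>, so \<open>T\<close>
  is a real subspace; then \<open>t = 1\<close> gives \<open>Im \<langle>u,v\<rangle> \<cdot> \<i>(v - u) \<in> T\<close>, and comparing this for \<open>u\<close> and \<open>u/2\<close>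
  gives \<open>\<i>u \<in> T\<close> whenever \<open>Im \<langle>u,v\<rangle> \<noteq> 0\<close>. Hence \<open>T\<close> is totally real, a complex line, or all of \<open>p\<^sup>\<bottom>\<close>.
\<close>

section \<open>The Hermitian form\<close>

lemma scaleR_eq_smult: "r *\<^sub>R (x :: complex ^ 3) = complex_of_real r *s x"
  by (simp add: vec_eq_iff scaleR_conv_of_real[where 'a = complex])

lemma herm_add_left: "herm (x + y) z = herm x z + herm y z"
  and herm_add_right: "herm z (x + y) = herm z x + herm z y"
  and herm_diff_left: "herm (x - y) z = herm x z - herm y z"
  and herm_diff_right: "herm z (x - y) = herm z x - herm z y"
  and herm_smult_left: "herm (c *s x) z = c * herm x z"
  and herm_smult_right: "herm z (c *s x) = cnj c * herm z x"
  and herm_scaleR_left: "herm (r *\<^sub>R x) z = of_real r * herm x z"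
  and herm_scaleR_right: "herm z (r *\<^sub>R x) = of_real r * herm z x"
  by (simp_all add: herm_def algebra_simps scaleR_conv_of_real[where 'a = complex])

lemma herm_zero [simp]: "herm 0 x = 0" "herm x 0 = 0"
  by (simp_all add: herm_def)

lemmas herm_linear = herm_add_left herm_add_right herm_diff_left herm_diff_right
  herm_smult_left herm_smult_right herm_scaleR_left herm_scaleR_right

lemma herm_commute: "herm y x = cnj (herm x y)"
  by (simp add: herm_def algebra_simps)

lemma herm_eq_0_commute: "herm x y = 0 \<longleftrightarrow> herm y x = 0"
  using herm_commute by (metis complex_cnj_zero_iff)

lemma herm_self_real: "herm x x = of_real (Re (herm x x))"
  by (rule complex_eqI) (simp_all add: herm_def algebra_simps)

text \<open>One Gram-Schmidt step. Because \<open>herm x y\<close> is real, the coefficient is real,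
  so the result stays in every real subspace containing \<open>x\<close> and
  \<open>y\<close>.\<close>

lemma herm_diff_proj:
  assumes "herm x y \<in> \<real>" "Re (herm y y) \<noteq> 0"
  shows "herm (x - (Re (herm x y) / Re (herm y y)) *\<^sub>R y) y = 0"
proof -
  have "herm x y = of_real (Re (herm x y))"
    using assms(1) by simp
  also have "\<dots> = of_real ((Re (herm x y) / Re (herm y y)) * Re (herm y y))"
    using assms(2) by simp
  also have "\<dots> = of_real (Re (herm x y) / Re (herm y y)) * herm y y"
    by (simp only: of_real_mult flip: herm_self_real)
  finally show ?thesis
    by (simp only: herm_diff_left herm_scaleR_left right_minus_eq)
qed

lemma Re_herm_self:
  "Re (herm x x) = - (cmod (x $ 0))\<^sup>2 + (cmod (x $ 1))\<^sup>2 + (cmod (x $ 2))\<^sup>2"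
  unfolding herm_def cmod_power2 by (simp add: power2_eq_square)

lemma continuous_on_herm [continuous_intros]:
  assumes "continuous_on S f" "continuous_on S g"
  shows "continuous_on S (\<lambda>x. herm (f x) (g x))"
  unfolding herm_def by (intro continuous_intros assms)

lemma continuous_on_smult [continuous_intros]:
  fixes f :: "'a :: topological_space \<Rightarrow> complex" and g :: "'a \<Rightarrow> complex ^ 3"
  assumes "continuous_on S f" "continuous_on S g"
  shows "continuous_on S (\<lambda>x. f x *s g x)"
  unfolding vector_scalar_mult_def by (intro continuous_intros assms)

section \<open>Negative vectors\<close>

definition neg :: "complex ^ 3 \<Rightarrow> bool" where
  "neg x \<longleftrightarrow> Re (herm x x) < 0"

lemma neg_nonzero: "neg x \<Longrightarrow> x \<noteq> 0"
  by (auto simp: neg_def)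

lemma open_neg: "open {x. neg x}"
  unfolding neg_def by (intro open_Collect_less continuous_intros)

lemma neg_smult:
  assumes "c \<noteq> 0"
  shows "neg (c *s x) \<longleftrightarrow> neg x"
proof -
  have "herm (c *s x) (c *s x) = of_real ((cmod c)\<^sup>2) * herm x x"
    unfolding complex_norm_square by (simp add: herm_linear)
  then have "Re (herm (c *s x) (c *s x)) = (cmod c)\<^sup>2 * Re (herm x x)"
    by (simp flip: of_real_power)
  then show ?thesis
    using assms by (simp add: neg_def mult_less_0_iff)
qed

text \<open>The form has only one minus sign. Orthogonality and Cauchy-Schwarz in coordinates 1 and
  2 bound \<open>a * a'\<close>; a nonpositive \<open>v\<close> would then contradict the strict
  inequality for \<open>p\<close> unless \<open>v = 0\<close>.\<close>

lemma herm_pos_of_orthogonal_neg: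
  assumes p: "neg p" and v: "herm v p = 0" and "v \<noteq> 0"
  shows "Re (herm v v) > 0"
proof (rule ccontr)
  define a where "a = cmod (v $ 0)"
  define b where "b = cmod (v $ 1)"
  define c where "c = cmod (v $ 2)"
  define a' where "a' = cmod (p $ 0)"
  define b' where "b' = cmod (p $ 1)"
  define c' where "c' = cmod (p $ 2)"
  note defs = a_def b_def c_def a'_def b'_def c'_def
  assume "\<not> ?thesis"
  then have 1: "b\<^sup>2 + c\<^sup>2 \<le> a\<^sup>2"
    using Re_herm_self[of v] by (simp add: defs)
  have 2: "b'\<^sup>2 + c'\<^sup>2 < a'\<^sup>2"
    using p Re_herm_self[of p] by (simp add: defs neg_def)
  have "v $ 0 * cnj (p $ 0) = v $ 1 * cnj (p $ 1) + v $ 2 * cnj (p $ 2)"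
    using v by (simp add: herm_def algebra_simps)
  then have "a * a' \<le> b * b' + c * c'"
    unfolding defs by (metis norm_mult complex_mod_cnj norm_triangle_ineq)
  then have "(a * a')\<^sup>2 \<le> (b * b' + c * c')\<^sup>2"
    by (rule power_mono) (simp add: defs)
  \<comment> \<open>Cauchy-Schwarz: the two sides differ by the square of
    \<open>b * c' - c * b'\<close>.\<close>
  also have "\<dots> \<le> (b\<^sup>2 + c\<^sup>2) * (b'\<^sup>2 + c'\<^sup>2)"
    using zero_le_power2[of "b * c' - c * b'"] by (simp add: power2_eq_square algebra_simps)
  also have "\<dots> \<le> a\<^sup>2 * (b'\<^sup>2 + c'\<^sup>2)"
    by (rule mult_right_mono[OF 1]) simp
  finally have "a\<^sup>2 * a'\<^sup>2 \<le> a\<^sup>2 * (b'\<^sup>2 + c'\<^sup>2)"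
    by (simp add: power_mult_distrib)
  with 2 have "a = 0"
    by (metis linorder_not_less mult_less_cancel_left_pos zero_eq_power2 zero_less_power2)
  with 1 have "a = 0" "b = 0" "c = 0"
    by (auto simp: sum_power2_le_zero_iff)
  then have "v $ 0 = 0" "v $ 1 = 0" "v $ 2 = 0"
    by (simp_all add: defs)
  \<comment> \<open>\<open>forall_3\<close> addresses coordinate 0 by the index 3.\<close>
  moreover have "(3 :: 3) = 0"
    by simp
  ultimately have "v $ 3 = 0"
    by metis
  with \<open>v $ 1 = 0\<close> \<open>v $ 2 = 0\<close> have "v = 0"
    by (simp add: vec_eq_iff forall_3)
  then show False using \<open>v \<noteq> 0\<close> by simp
qed

lemma herm_neg_nonzero:
  assumes "neg x" "neg y"
  shows "herm x y \<noteq> 0"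
  using assms herm_pos_of_orthogonal_neg[of y x] neg_nonzero[of x] by (auto simp: neg_def)

text \<open>The product in the third hypothesis is \<open>c * cnj d * herm x y\<close>, so
  \<open>c * cnj d\<close> is real and \<open>c\<close> is a real multiple of \<open>d\<close>. This
  aligns the phases of two lifts taken from a real-valued subspace.\<close>

lemma herm_real_ratio:
  assumes "herm x y \<in> \<real>" "herm x y \<noteq> 0" "herm (c *s x) (d *s y) \<in> \<real>" "d \<noteq> 0"
  shows "c = of_real (Re (c * cnj d) / (cmod d)\<^sup>2) * d"
proof -
  have "(c * cnj d) * herm x y \<in> \<real>"
    using assms(3) by (simp add: herm_linear mult_ac)
  then have "(c * cnj d) * herm x y / herm x y \<in> \<real>"
    using assms(1) by (rule Reals_divide)
  then have "c * cnj d \<in> \<real>"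
    using assms(2) by simp
  then have "of_real (Re (c * cnj d)) = c * cnj d"
    by (rule of_real_Re)
  then show ?thesis
    unfolding of_real_divide complex_norm_square using assms(4) by simp
qed

text \<open>In the expansion as a quadratic polynomial in \<open>t\<close>, the constant term is
  negative and the other two terms are nonpositive.\<close>

lemma neg_add_scaleR:
  assumes "neg x" "neg y" "Re (herm x y) \<le> 0" "t \<ge> 0"
  shows "neg (x + t *\<^sub>R y)"
proof -
  have "Re (herm y x) = Re (herm x y)"
    by (simp add: herm_commute[of y x])
  then have "Re (herm (x + t *\<^sub>R y) (x + t *\<^sub>R y)) =
      Re (herm x x) + 2 * (t * Re (herm x y)) + t\<^sup>2 * Re (herm y y)"
    by (simp add: herm_linear algebra_simps power2_eq_square)
  moreover have "t * Re (herm x y) \<le> 0" "t\<^sup>2 * Re (herm y y) \<le> 0"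
    using assms by (auto simp: neg_def mult_le_0_iff)
  ultimately show ?thesis
    using assms(1) by (simp add: neg_def)
qed

lemma eventually_neg_add_scaleR:
  assumes "neg p"
  shows "\<forall>\<^sub>F t in at_right (0::real). neg (p + t *\<^sub>R v)"
proof -
  have "((\<lambda>t::real. p + t *\<^sub>R v) \<longlongrightarrow> p + 0 *\<^sub>R v) (at_right 0)"
    by (intro tendsto_intros)
  then show ?thesis
    using topological_tendstoD[OF _ open_neg] assms by force
qed

section \<open>Orthogonal systems and spans\<close>

lemma herm_orthogonal_independent:
  assumes "pairwise (\<lambda>x y. herm x y = 0) S" "\<forall>x\<in>S. herm x x \<noteq> 0"
  shows "vec.independent S" "independent S"
proof -
  have *: "herm y x = 0" if "x \<in> S" "y \<in> vec.span (S - {x})" for x y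
    using that(2)
  proof (induction rule: vec.span_induct_alt)
    case base
    then show ?case by simp
  next
    case (step c z y)
    then show ?case
      using assms(1) that(1) by (auto simp: herm_linear pairwise_def)
  qed
  then show "vec.independent S"
    unfolding vec.dependent_def using assms(2) by blast
  have "herm y x = 0" if "x \<in> S" "y \<in> span (S - {x})" for x y
    using that(2)
  proof (induction rule: span_induct_alt)
    case base
    then show ?case by simp
  next
    case (step c z y)
    then show ?case
      using assms(1) that(1) by (auto simp: herm_linear pairwise_def)
  qed
  then show "independent S"
    unfolding dependent_def using assms(2) by blast
qed

lemma vec_dim_complex_3: "vec.dim (UNIV :: (complex ^ 3) set) = 3"
  unfolding vec_dim_card by simp

lemma real_valued_on_span:
  assumes "real_valued_on S"
  shows "real_valued_on (span S)"
proof -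
  have 1: "herm x y \<in> \<real>" if "x \<in> span S" "y \<in> S" for x y
    using that(1)
    by (induction rule: span_induct_alt)
      (use assms that(2) in \<open>auto simp: herm_linear real_valued_on_def\<close>)
  have "herm x y \<in> \<real>" if "x \<in> span S" "y \<in> span S" for x y
    using that(2)
    by (induction rule: span_induct_alt)
      (use 1 that(1) in \<open>auto simp: herm_linear\<close>)
  then show ?thesis by (simp add: real_valued_on_def)
qed

lemma herm_span_orthogonal:
  assumes "\<forall>x\<in>B. herm x p = 0" "x \<in> span B"
  shows "herm x p = 0"
  using assms(2) by (induction rule: span_induct_alt) (use assms(1) in \<open>auto simp: herm_linear\<close>)

text \<open>Pairing with \<open>p\<close> reads off the \<open>p\<close>-coefficient, which must
  vanish. This computes the chart directions of the set given by
  \<open>span (insert p B)\<close>.\<close>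

lemma span_insert_orthogonal:
  assumes "neg p" "\<forall>x\<in>B. herm x p = 0"
  shows "{x \<in> span (insert p B). herm x p = 0} = span B"
proof -
  have "x \<in> span B" if x: "x \<in> span (insert p B)" "herm x p = 0" for x
  proof -
    obtain k where k: "x - k *\<^sub>R p \<in> span B"
      using x(1) by (auto simp: span_breakdown_eq)
    have "herm (x - k *\<^sub>R p) p = 0"
      by (rule herm_span_orthogonal[OF assms(2) k])
    then have "k = 0"
      using x(2) assms(1) by (auto simp: herm_linear neg_def)
    with k show ?thesis by simp
  qed
  moreover have "span B \<subseteq> span (insert p B)"
    by (intro span_mono) auto
  ultimately show ?thesis
    using herm_span_orthogonal[OF assms(2)] by auto
qed

section \<open>Points of the hyperbolic plane\<close>

lemma cp2_eq_iff:
  assumes "x \<noteq> 0" "y \<noteq> 0"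
  shows "cp2_of x = cp2_of y \<longleftrightarrow> (\<exists>c. y = c *s x)"
proof -
  have "proj_rel x x" "proj_rel y y"
    using assms by (auto simp: proj_rel_def intro: exI[of _ 1])
  then have "cp2_of x = cp2_of y \<longleftrightarrow> proj_rel x y"
    using Quotient3_rel[OF Quotient3_cp2, of x y] by auto
  then show ?thesis
    using assms by (auto simp: proj_rel_def)
qed

lemma cp2_of_smult: "x \<noteq> 0 \<Longrightarrow> c \<noteq> 0 \<Longrightarrow> cp2_of (c *s x) = cp2_of x"
  by (metis cp2_eq_iff vector_mul_eq_0)

text \<open>The set \<open>W\<close> may be only a real subspace, so the chosen lift
  \<open>x\<close> can lie outside it although another lift of the same point lies inside.\<close>

lemma cp2_of_in_projectivize:
  assumes "x \<noteq> 0"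
  shows "cp2_of x \<in> projectivize W \<longleftrightarrow> (\<exists>c. c \<noteq> 0 \<and> c *s x \<in> W)"
proof
  assume "cp2_of x \<in> projectivize W"
  then obtain y where "y \<in> W" "y \<noteq> 0" "cp2_of x = cp2_of y"
    by (auto simp: projectivize_def)
  then show "\<exists>c. c \<noteq> 0 \<and> c *s x \<in> W"
    using cp2_eq_iff[OF assms, of y] by (metis vector_smult_lzero)
next
  assume "\<exists>c. c \<noteq> 0 \<and> c *s x \<in> W"
  then obtain c where "c \<noteq> 0" "c *s x \<in> W" by blast
  then show "cp2_of x \<in> projectivize W"
    unfolding projectivize_def using assms cp2_of_smult[OF assms, of c]
    by (intro image_eqI[of _ _ "c *s x"]) auto
qed

lemma cp2_of_in_hyp_plane: "x \<noteq> 0 \<Longrightarrow> cp2_of x \<in> hyp_plane \<longleftrightarrow> neg x"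
  unfolding hyp_plane_def neg_def[symmetric]
  by (auto simp: cp2_eq_iff neg_nonzero) (metis neg_smult neg_nonzero vector_smult_lzero)

lemma hyp_planeE:
  assumes "x \<in> hyp_plane"
  obtains p where "neg p" "x = cp2_of p"
  using assms by (auto simp: hyp_plane_def neg_def)

lemma hyp_planeE_unit:
  assumes "x \<in> hyp_plane"
  obtains p where "herm p p = -1" "x = cp2_of p"
proof -
  obtain q where q: "neg q" "x = cp2_of q"
    using assms by (rule hyp_planeE)
  define r where "r = 1 / sqrt (- Re (herm q q))"
  have r: "r \<noteq> 0" "r * r * Re (herm q q) = -1"
    using q(1) by (auto simp: r_def neg_def field_simps)
  have "herm (r *\<^sub>R q) (r *\<^sub>R q) = of_real (r * r * Re (herm q q))"
    by (subst of_real_mult, subst herm_self_real[symmetric]) (simp add: herm_linear)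
  then have "herm (r *\<^sub>R q) (r *\<^sub>R q) = -1"
    by (simp only: r(2)) simp
  moreover have "x = cp2_of (r *\<^sub>R q)"
    using q r by (simp add: scaleR_eq_smult cp2_of_smult neg_nonzero)
  ultimately show thesis by (rule that)
qed

text \<open>Since \<open>hyp_plane\<close> is open, relative closedness is openness of the
  complement, and the quotient topology tests this on lifts.\<close>

lemma closedin_hyp_plane_iff:
  assumes "C \<subseteq> hyp_plane"
  shows "closedin (top_of_set hyp_plane) C \<longleftrightarrow> open {x. neg x \<and> cp2_of x \<notin> C}"
proof -
  have *: "{x. x \<noteq> 0 \<and> cp2_of x \<in> hyp_plane - S} = {x. neg x \<and> cp2_of x \<notin> S}" for S
    using cp2_of_in_hyp_plane neg_nonzero by blast
  have "open hyp_plane"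
    using *[of "{}"] open_neg by (simp add: open_cp2_def)
  then have "closedin (top_of_set hyp_plane) C \<longleftrightarrow> open (hyp_plane - C)"
    using assms by (simp add: closedin_def openin_open_eq)
  then show ?thesis
    unfolding open_cp2_def * .
qed

section \<open>Geodesics, complex geodesics and real planes\<close>

lemma geodesic_orthogonalI:
  assumes "neg p" "herm u p = 0" "u \<noteq> 0"
  shows "is_geodesic (hyp_plane \<inter> projectivize (span {p, u}))"
proof -
  have u: "Re (herm u u) > 0"
    using herm_pos_of_orthogonal_neg assms by auto
  have p: "Re (herm p p) < 0"
    using assms(1) by (simp add: neg_def)
  have "p \<noteq> u"
    using u p by auto
  have pu: "herm p u = 0"
    using assms(2) by (simp add: herm_eq_0_commute)
  have orth: "pairwise (\<lambda>x y. herm x y = 0) {p, u}"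
    using assms(2) pu by (auto simp: pairwise_def)
  then have ind: "independent {p, u}"
    by (rule herm_orthogonal_independent(2)) (use u p in auto)
  have "real_signature (span {p, u}) 1 1"
    unfolding real_signature_def herm_orthogonal_def
    by (rule exI[of _ "{p}"], rule exI[of _ "{u}"])
      (use orth ind u p in \<open>auto simp: insert_commute\<close>)
  moreover have "real_valued_on {p, u}"
    using herm_self_real[of p] herm_self_real[of u] assms(2) pu
    by (auto simp: real_valued_on_def) (metis Reals_of_real)+
  then have "real_valued_on (span {p, u})"
    by (rule real_valued_on_span)
  moreover have "dim (span {p, u}) = 2"
    using dim_span_eq_card_independent[OF ind] \<open>p \<noteq> u\<close> by simp
  ultimately show ?thesis
    unfolding is_geodesic_def by (intro exI[of _ "span {p, u}"]) simp
qed

text \<open>Gram-Schmidt reduces this to an orthogonal pair: the component of \<open>q\<close> along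
  \<open>p\<close> is real, so removing it leaves the real span unchanged.\<close>

lemma geodesicI:
  assumes "neg p" "neg q" "herm p q \<in> \<real>" "cp2_of p \<noteq> cp2_of q"
  shows "is_geodesic (hyp_plane \<inter> projectivize (span {p, q}))"
proof -
  define r where "r = Re (herm q p) / Re (herm p p)"
  define u where "u = q - r *\<^sub>R p"
  have q: "q = u + r *\<^sub>R p"
    by (simp add: u_def)
  have p0: "p \<noteq> 0" "Re (herm p p) \<noteq> 0" and "q \<noteq> 0"
    using assms(1,2) by (auto simp: neg_def)
  have "herm q p \<in> \<real>"
    using assms(3) herm_commute[of p q] by (simp add: Reals_cnj_iff)
  then have up: "herm u p = 0"
    unfolding u_def r_def using p0(2) by (rule herm_diff_proj)
  have "u \<noteq> 0"
  proof
    assume "u = 0"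
    then have "q = of_real r *s p"
      by (simp add: q scaleR_eq_smult)
    then show False
      using assms(4) cp2_eq_iff[OF p0(1) \<open>q \<noteq> 0\<close>] by blast
  qed
  have "u + r *\<^sub>R p \<in> span {p, u}" "q - r *\<^sub>R p \<in> span {p, q}"
    by (intro span_add span_diff span_scale span_base; simp)+
  then have "q \<in> span {p, u}" "u \<in> span {p, q}"
    by (simp_all flip: q u_def)
  then have "span {p, q} = span {p, u}"
    by (auto simp: span_eq span_base)
  with geodesic_orthogonalI[OF assms(1) up \<open>u \<noteq> 0\<close>] show ?thesis
    by simp
qed

text \<open>Lifts of distinct points are independent over the reals, so two lifts chosen in the
  two-dimensional \<open>W\<close> already span it.\<close>

lemma geodesicE:
  assumes "is_geodesic G" "x \<in> G" "y \<in> G" "x \<noteq> y"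
  obtains a b where "neg a" "neg b" "x = cp2_of a" "y = cp2_of b" "herm a b \<in> \<real>"
    "G = hyp_plane \<inter> projectivize (span {a, b})"
proof -
  obtain W where W: "subspace W" "dim W = 2" "real_valued_on W" "G = hyp_plane \<inter> projectivize W"
    using assms(1) unfolding is_geodesic_def by blast
  obtain a b where a: "a \<in> W" "a \<noteq> 0" "x = cp2_of a" and b: "b \<in> W" "b \<noteq> 0" "y = cp2_of b"
    using assms(2,3) unfolding W(4) projectivize_def by auto
  have n: "neg a" "neg b"
    using assms(2,3) a b W(4) cp2_of_in_hyp_plane by auto
  have "independent {b, a}"
  proof -
    have "b \<notin> span {a}"
      using a b assms(4) cp2_eq_iff[of a b] by (auto simp: span_singleton scaleR_eq_smult)
    then show ?thesis
      using a(2) by (subst independent_insert) auto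
  qed
  moreover have "a \<noteq> b"
    using a b assms(4) by auto
  then have "card {b, a} = 2"
    by simp
  ultimately have "W \<subseteq> span {a, b}"
    using card_ge_dim_independent[of "{b, a}" W] a b W(2) by (simp add: insert_commute)
  moreover have "span {a, b} \<subseteq> W"
    using a b W(1) by (intro span_minimal) auto
  ultimately have "W = span {a, b}" by blast
  then show thesis
    using that[of a b] n a b W(3,4) by (auto simp: real_valued_on_def)
qed

lemma real_planeE:
  assumes "is_real_plane R"
  obtains p u v where "neg p" "herm u p = 0" "herm v p = 0" "herm u v = 0" "u \<noteq> v"
    "Re (herm u u) > 0" "Re (herm v v) > 0" "real_valued_on (span {p, u, v})"
    "R = hyp_plane \<inter> projectivize (span {p, u, v})"
proof -
  obtain W where W: "real_valued_on W" "real_signature W 1 2" "R = hyp_plane \<inter> projectivize W"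
    using assms unfolding is_real_plane_def by blast
  obtain N P where NP: "herm_orthogonal N P" "card N = 1" "card P = 2" "span (N \<union> P) = W"
    using W(2) unfolding real_signature_def by blast
  obtain p where p: "N = {p}"
    using NP(2) by (auto simp: card_1_singleton_iff)
  obtain u v where uv: "P = {u, v}" "u \<noteq> v"
    using NP(3) by (auto simp: card_2_iff)
  have *: "neg p" "Re (herm u u) > 0" "Re (herm v v) > 0"
    using NP(1) by (auto simp: herm_orthogonal_def p uv neg_def)
  then have "u \<noteq> p" "v \<noteq> p"
    by (auto simp: neg_def)
  then have "herm u p = 0" "herm v p = 0" "herm u v = 0"
    using NP(1) uv(2) by (auto simp: herm_orthogonal_def p uv(1) pairwise_def)
  with * uv(2) NP(4) W show thesis
    by (intro that[of p u v]) (auto simp: p uv insert_commute)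
qed

lemma real_planeI:
  assumes "neg p" "herm u p = 0" "herm v p = 0" "herm u v = 0" "u \<noteq> 0" "v \<noteq> 0"
  shows "is_real_plane (hyp_plane \<inter> projectivize (span {p, u, v}))"
proof -
  have u: "Re (herm u u) > 0" and v: "Re (herm v v) > 0"
    using herm_pos_of_orthogonal_neg[OF assms(1)] assms by auto
  have p: "Re (herm p p) < 0"
    using assms(1) by (simp add: neg_def)
  have ne: "p \<noteq> u" "p \<noteq> v" "u \<noteq> v"
    using assms u v p by auto
  have sym: "herm p u = 0" "herm p v = 0" "herm v u = 0"
    using assms by (simp_all add: herm_eq_0_commute)
  have orth: "pairwise (\<lambda>x y. herm x y = 0) {p, u, v}"
    using assms sym by (auto simp: pairwise_def)
  then have ind: "independent {p, u, v}"
    by (rule herm_orthogonal_independent(2)) (use u v p in auto)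
  have "real_signature (span {p, u, v}) 1 2"
    unfolding real_signature_def herm_orthogonal_def
    by (rule exI[of _ "{p}"], rule exI[of _ "{u, v}"])
      (use orth ind u v p ne in \<open>auto simp: neg_def insert_commute\<close>)
  moreover have "real_valued_on {p, u, v}"
    using herm_self_real[of p] herm_self_real[of u] herm_self_real[of v] assms sym
    by (auto simp: real_valued_on_def) (metis Reals_of_real)+
  then have "real_valued_on (span {p, u, v})"
    by (rule real_valued_on_span)
  moreover have "dim (span {p, u, v}) = 3"
    using dim_span_eq_card_independent[OF ind] ne by simp
  ultimately show ?thesis
    unfolding is_real_plane_def by (intro exI[of _ "span {p, u, v}"]) simp
qed

lemma complex_geodesicE:
  assumes "is_complex_geodesic G"
  obtains p u where "neg p" "herm u p = 0" "Re (herm u u) > 0"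
    "G = hyp_plane \<inter> projectivize (vec.span {p, u})"
proof -
  obtain W where W: "complex_signature W 1 1" "G = hyp_plane \<inter> projectivize W"
    using assms unfolding is_complex_geodesic_def by blast
  obtain N P where NP: "herm_orthogonal N P" "card N = 1" "card P = 1" "vec.span (N \<union> P) = W"
    using W(1) unfolding complex_signature_def by blast
  obtain p u where pu: "N = {p}" "P = {u}"
    using NP(2,3) by (auto simp: card_1_singleton_iff)
  have *: "neg p" "Re (herm u u) > 0"
    using NP(1) by (auto simp: herm_orthogonal_def pu neg_def)
  then have "u \<noteq> p"
    by (auto simp: neg_def)
  then have "herm u p = 0"
    using NP(1) by (auto simp: herm_orthogonal_def pu pairwise_def)
  with * NP(4) W show thesis
    by (intro that[of p u]) (auto simp: pu insert_commute)
qed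

lemma complex_geodesicI:
  assumes "neg p" "herm u p = 0" "u \<noteq> 0"
  shows "is_complex_geodesic (hyp_plane \<inter> projectivize (vec.span {p, u}))"
proof -
  have u: "Re (herm u u) > 0"
    using herm_pos_of_orthogonal_neg assms by auto
  have p: "Re (herm p p) < 0"
    using assms(1) by (simp add: neg_def)
  have "p \<noteq> u"
    using u p by auto
  have orth: "pairwise (\<lambda>x y. herm x y = 0) {p, u}"
    using assms herm_eq_0_commute[of p u] by (auto simp: pairwise_def)
  then have ind: "vec.independent {p, u}"
    by (rule herm_orthogonal_independent(1)) (use u p in auto)
  have "complex_signature (vec.span {p, u}) 1 1"
    unfolding complex_signature_def herm_orthogonal_def
    by (rule exI[of _ "{p}"], rule exI[of _ "{u}"])
      (use orth ind u p in \<open>auto simp: neg_def insert_commute\<close>)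
  moreover have "vec.dim (vec.span {p, u}) = 2"
    using vec.dim_span_eq_card_independent[OF ind] \<open>p \<noteq> u\<close> by simp
  ultimately show ?thesis
    unfolding is_complex_geodesic_def by (intro exI[of _ "vec.span {p, u}"]) simp
qed

section \<open>Slices\<close>

text \<open>In the affine chart centred at \<open>[p]\<close>, with points \<open>[p + v]\<close> for \<open>v\<close> orthogonal to \<open>p\<close>,
  the geodesics through \<open>[p]\<close> are the real lines through \<open>0\<close>.\<close>

definition slice :: "complex ^ 3 \<Rightarrow> (complex ^ 3) set \<Rightarrow> cp2 set" where
  "slice p T = {cp2_of (p + v) | v. v \<in> T \<and> neg (p + v)}"

text \<open>Injectivity of the chart: pairing with \<open>p\<close> forces the scalar relating the
  two lifts to be 1.\<close>

lemma cp2_of_add_eq_iff: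
  assumes "neg p" "herm v p = 0" "herm w p = 0" "neg (p + v)" "neg (p + w)"
  shows "cp2_of (p + v) = cp2_of (p + w) \<longleftrightarrow> v = w"
proof
  assume "cp2_of (p + v) = cp2_of (p + w)"
  then obtain c where c: "p + w = c *s (p + v)"
    using cp2_eq_iff[OF neg_nonzero neg_nonzero] assms by blast
  then have "herm (p + w) p = herm (c *s (p + v)) p"
    by simp
  then have "c = 1"
    using assms by (auto simp: herm_linear neg_def)
  with c show "v = w" by simp
qed auto

lemma cp2_of_in_slice:
  assumes "neg p" "\<forall>v\<in>T. herm v p = 0" "herm w p = 0" "neg (p + w)"
  shows "cp2_of (p + w) \<in> slice p T \<longleftrightarrow> w \<in> T"
  unfolding slice_def using cp2_of_add_eq_iff[OF assms(1)] assms by blast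

text \<open>Surjectivity of the chart. The scalar is split into a real \<open>s\<close> and
  \<open>cnj (herm y p)\<close> so that closure under the second factor suffices to keep the vector
  in a real subspace.\<close>

lemma hyp_planeE_add:
  assumes p: "neg p" and y: "neg y"
  obtains s where "s \<noteq> 0" "herm (s *\<^sub>R (cnj (herm y p) *s y) - p) p = 0"
    "cp2_of (p + (s *\<^sub>R (cnj (herm y p) *s y) - p)) = cp2_of y"
    "neg (p + (s *\<^sub>R (cnj (herm y p) *s y) - p))"
proof -
  have h: "herm y p \<noteq> 0"
    using herm_neg_nonzero assms by blast
  \<comment> \<open>With this \<open>s\<close>, the rescaled \<open>y\<close> has the same product
    with \<open>p\<close> as \<open>p\<close> itself.\<close>
  define s where "s = Re (herm p p) / (cmod (herm y p))\<^sup>2"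
  have "of_real s * (cnj (herm y p) * herm y p) = of_real (Re (herm p p))"
    using h unfolding s_def of_real_divide complex_norm_square by simp
  then have "herm (s *\<^sub>R (cnj (herm y p) *s y) - p) p = 0"
    using herm_self_real[of p] by (simp add: herm_linear)
  moreover have s: "s \<noteq> 0"
    using p h by (auto simp: s_def neg_def)
  moreover have "p + (s *\<^sub>R (cnj (herm y p) *s y) - p) = (of_real s * cnj (herm y p)) *s y"
    by (simp add: scaleR_eq_smult vector_smult_assoc)
  moreover have "of_real s * cnj (herm y p) \<noteq> 0"
    using s h by simp
  ultimately show thesis
    using that[of s] y cp2_of_smult neg_smult neg_nonzero by metis
qed

text \<open>A common setting for real-valued and complex subspaces. For negative \<open>x\<close>,
  the vector \<open>cnj (herm x p) *s x\<close> is a lift of the same point whose product with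
  \<open>p\<close> is positive; \<open>polar\<close> keeps this normalised lift in
  \<open>W\<close>.\<close>

locale polar_subspace =
  fixes p :: "complex ^ 3" and W :: "(complex ^ 3) set"
  assumes neg: "neg p" and p_in: "p \<in> W" and sub: "subspace W"
    and polar: "x \<in> W \<Longrightarrow> cnj (herm x p) *s x \<in> W"
begin

lemma hyp_plane_projectivize_eq_slice:
  "hyp_plane \<inter> projectivize W = slice p {v \<in> W. herm v p = 0}"
proof (intro equalityI subsetI)
  fix x assume x: "x \<in> hyp_plane \<inter> projectivize W"
  then obtain y where y: "y \<in> W" "y \<noteq> 0" "x = cp2_of y"
    by (auto simp: projectivize_def)
  then have "neg y"
    using x cp2_of_in_hyp_plane by auto
  then show "x \<in> slice p {v \<in> W. herm v p = 0}"
  proof (rule hyp_planeE_add[OF neg])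
    fix s assume "s \<noteq> 0" "herm (s *\<^sub>R (cnj (herm y p) *s y) - p) p = 0"
      "cp2_of (p + (s *\<^sub>R (cnj (herm y p) *s y) - p)) = cp2_of y"
      "neg (p + (s *\<^sub>R (cnj (herm y p) *s y) - p))"
    moreover have "s *\<^sub>R (cnj (herm y p) *s y) - p \<in> W"
      by (intro subspace_diff[OF sub] subspace_scale[OF sub] polar y p_in)
    ultimately show ?thesis
      unfolding slice_def y(3) by (metis (mono_tags, lifting) mem_Collect_eq)
  qed
next
  fix x assume "x \<in> slice p {v \<in> W. herm v p = 0}"
  then obtain v where v: "v \<in> W" "neg (p + v)" "x = cp2_of (p + v)"
    by (auto simp: slice_def)
  have "p + v \<in> W"
    by (intro subspace_add[OF sub] p_in v)
  then show "x \<in> hyp_plane \<inter> projectivize W"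
    using v cp2_of_in_hyp_plane neg_nonzero[OF v(2)] by (auto simp: projectivize_def)
qed

text \<open>Replacing \<open>x\<close> by \<open>c *s x\<close> multiplies the normalised lift by
  the positive real \<open>(cmod c)\<^sup>2\<close>. Hence the search for a scalar becomes a
  condition continuous in \<open>x\<close>, which yields closedness.\<close>

lemma cp2_of_in_projectivize_iff:
  assumes "neg x"
  shows "cp2_of x \<in> projectivize W \<longleftrightarrow> cnj (herm x p) *s x \<in> W"
proof
  assume "cp2_of x \<in> projectivize W"
  then obtain c where c: "c \<noteq> 0" "c *s x \<in> W"
    using cp2_of_in_projectivize[OF neg_nonzero[OF assms]] by blast
  have "cnj (herm (c *s x) p) *s (c *s x) = (cmod c)\<^sup>2 *\<^sub>R (cnj (herm x p) *s x)"
    unfolding scaleR_eq_smult complex_norm_square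
    by (simp add: herm_linear vector_smult_assoc mult_ac)
  then have "(cmod c)\<^sup>2 *\<^sub>R (cnj (herm x p) *s x) \<in> W"
    using polar[OF c(2)] by simp
  then have "(1 / (cmod c)\<^sup>2) *\<^sub>R ((cmod c)\<^sup>2 *\<^sub>R (cnj (herm x p) *s x)) \<in> W"
    by (rule subspace_scale[OF sub])
  then show "cnj (herm x p) *s x \<in> W"
    using c(1) by simp
next
  assume "cnj (herm x p) *s x \<in> W"
  moreover have "cnj (herm x p) \<noteq> 0"
    using herm_neg_nonzero[OF assms neg] by simp
  ultimately show "cp2_of x \<in> projectivize W"
    using cp2_of_in_projectivize[OF neg_nonzero[OF assms]] by blast
qed

lemma closedin_hyp_plane_projectivize:
  "closedin (top_of_set hyp_plane) (hyp_plane \<inter> projectivize W)"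
proof -
  have "{x. neg x \<and> cp2_of x \<notin> hyp_plane \<inter> projectivize W} =
      {x. neg x} \<inter> (\<lambda>x. cnj (herm x p) *s x) -` (- W)"
    using cp2_of_in_projectivize_iff cp2_of_in_hyp_plane neg_nonzero by auto
  also have "open \<dots>"
    by (intro open_Int open_neg open_vimage continuous_intros)
      (use closed_subspace[OF sub] in auto)
  finally show ?thesis
    by (subst closedin_hyp_plane_iff) auto
qed

text \<open>A common scalar taking \<open>a\<close> and \<open>b\<close> into \<open>W\<close> takes
  their whole real span there, and this span gives the geodesic through the two points.\<close>

lemma complete_totally_geodesicI:
  assumes "\<And>a b. neg a \<Longrightarrow> neg b \<Longrightarrow> herm a b \<in> \<real> \<Longrightarrow> cp2_of a \<in> projectivize W \<Longrightarrow>
    cp2_of b \<in> projectivize W \<Longrightarrow> \<exists>c. c \<noteq> 0 \<and> c *s a \<in> W \<and> c *s b \<in> W"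
  shows "complete_totally_geodesic (hyp_plane \<inter> projectivize W)"
  unfolding complete_totally_geodesic_def
proof (intro conjI ballI impI allI closedin_hyp_plane_projectivize; (elim conjE)?)
  fix x y G
  assume x: "x \<in> hyp_plane \<inter> projectivize W" and y: "y \<in> hyp_plane \<inter> projectivize W"
    and "x \<noteq> y" "is_geodesic G" "x \<in> G" "y \<in> G"
  then obtain a b where ab: "neg a" "neg b" "x = cp2_of a" "y = cp2_of b" "herm a b \<in> \<real>"
    and G: "G = hyp_plane \<inter> projectivize (span {a, b})"
    using geodesicE by metis
  then obtain c where c: "c \<noteq> 0" "c *s a \<in> W" "c *s b \<in> W"
    using assms x y by blast
  have "c *s z \<in> W" if "z \<in> span {a, b}" for z
    using that
  proof (induction rule: span_induct_alt)
    case base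
    then show ?case
      using subspace_0[OF sub] by simp
  next
    case (step r z y)
    have "c *s (r *\<^sub>R z + y) = r *\<^sub>R (c *s z) + c *s y"
      by (simp add: scaleR_eq_smult vector_smult_assoc vector_add_ldistrib mult.commute)
    moreover have "c *s z \<in> W"
      using step c by auto
    ultimately show ?case
      using step subspace_add[OF sub] subspace_scale[OF sub] by metis
  qed
  then show "G \<subseteq> hyp_plane \<inter> projectivize W"
    unfolding G using c(1) cp2_of_in_projectivize by (fastforce simp: projectivize_def)
qed auto

end

section \<open>Real-valued and complex subspaces give complete totally geodesic sets\<close>

lemma polar_subspace_real:
  assumes "neg p" "p \<in> W" "subspace W" "real_valued_on W"
  shows "polar_subspace p W"
proof
  fix x assume x: "x \<in> W"
  then have "herm x p \<in> \<real>"
    using assms by (auto simp: real_valued_on_def)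
  then have "cnj (herm x p) *s x = Re (herm x p) *\<^sub>R x"
    by (simp add: scaleR_eq_smult Reals_cnj_iff)
  then show "cnj (herm x p) *s x \<in> W"
    using subspace_scale[OF assms(3) x] by simp
qed (use assms in auto)

lemma polar_subspace_complex:
  assumes "neg p" "p \<in> W" "vec.subspace W"
  shows "polar_subspace p W"
proof
  show "subspace W"
    using assms(3) by (auto simp: subspace_def vec.subspace_def scaleR_eq_smult)
qed (use assms vec.subspace_scale in auto)

text \<open>A complex subspace contains every lift of each of its points, so the common scalar can
  be 1.\<close>

lemma complete_totally_geodesic_complex:
  assumes "neg p" "p \<in> W" "vec.subspace W"
  shows "complete_totally_geodesic (hyp_plane \<inter> projectivize W)"
proof -
  interpret polar_subspace p W
    using assms by (rule polar_subspace_complex)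
  show ?thesis
  proof (rule complete_totally_geodesicI)
    fix a b
    assume "neg a" "neg b" and P: "cp2_of a \<in> projectivize W" "cp2_of b \<in> projectivize W"
    then have ab: "a \<noteq> 0" "b \<noteq> 0"
      by (auto simp: neg_nonzero)
    have "x \<in> W" if x: "cp2_of x \<in> projectivize W" "x \<noteq> 0" for x
    proof -
      obtain c where "c \<noteq> 0" "c *s x \<in> W"
        using x cp2_of_in_projectivize by blast
      then have "inverse c *s (c *s x) \<in> W"
        using vec.subspace_scale[OF assms(3)] by blast
      with \<open>c \<noteq> 0\<close> show ?thesis
        by (simp add: vector_smult_assoc)
    qed
    then show "\<exists>c. c \<noteq> 0 \<and> c *s a \<in> W \<and> c *s b \<in> W"
      using P ab by (intro exI[of _ 1]) auto
  qed
qed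

text \<open>The scalars taking \<open>a\<close> and \<open>b\<close> into \<open>W\<close> are real
  multiples of each other by \<open>herm_real_ratio\<close>, so the scalar for \<open>a\<close> also
  serves \<open>b\<close>.\<close>

lemma complete_totally_geodesic_real:
  assumes "neg p" "p \<in> W" "subspace W" "real_valued_on W"
  shows "complete_totally_geodesic (hyp_plane \<inter> projectivize W)"
proof -
  interpret polar_subspace p W
    using assms by (rule polar_subspace_real)
  show ?thesis
  proof (rule complete_totally_geodesicI)
    fix a b
    assume ab: "neg a" "neg b" "herm a b \<in> \<real>"
      and P: "cp2_of a \<in> projectivize W" "cp2_of b \<in> projectivize W"
    obtain c d where c: "c \<noteq> 0" "c *s a \<in> W" and d: "d \<noteq> 0" "d *s b \<in> W"
      using P ab cp2_of_in_projectivize neg_nonzero by meson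
    have "herm (c *s a) (d *s b) \<in> \<real>"
      using assms(4) c d by (simp add: real_valued_on_def)
    then have "c = of_real (Re (c * cnj d) / (cmod d)\<^sup>2) * d"
      using herm_real_ratio ab(3) herm_neg_nonzero[OF ab(1,2)] d(1) by blast
    then have "c *s b = (Re (c * cnj d) / (cmod d)\<^sup>2) *\<^sub>R (d *s b)"
      by (metis scaleR_eq_smult vector_smult_assoc)
    then have "c *s b \<in> W"
      using subspace_scale[OF assms(3) d(2)] by simp
    with c show "\<exists>c. c \<noteq> 0 \<and> c *s a \<in> W \<and> c *s b \<in> W"
      by blast
  qed
qed

section \<open>Non-triviality of complex geodesics and real planes\<close>

lemma not_trivial_slice:
  assumes p: "neg p" and T: "subspace T" "\<forall>v\<in>T. herm v p = 0"
    and uv: "u \<in> T" "v \<in> T" "u \<noteq> v" "independent {u, v}"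
    and z: "herm z p = 0" "z \<notin> T"
  shows "\<not> trivial_set (slice p T)"
proof -
  \<comment> \<open>A small \<open>t\<close> brings the three test directions into the domain of the
    chart.\<close>
  have "\<forall>\<^sub>F t in at_right (0::real). 0 < t \<and> neg (p + t *\<^sub>R u) \<and> neg (p + t *\<^sub>R v) \<and> neg (p + t *\<^sub>R z)"
    by (intro eventually_conj eventually_neg_add_scaleR p eventually_at_right_less)
  then obtain t :: real where t: "t > 0" "neg (p + t *\<^sub>R u)" "neg (p + t *\<^sub>R v)" "neg (p + t *\<^sub>R z)"
    using eventually_happens[of _ "at_right (0::real)"] by (auto simp: trivial_limit_at_right_real)
  have tu: "t *\<^sub>R u \<in> T" "t *\<^sub>R v \<in> T"
    using subspace_scale[OF T(1)] uv by auto
  have mem: "cp2_of (p + t *\<^sub>R u) \<in> slice p T" "cp2_of (p + t *\<^sub>R v) \<in> slice p T"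
    using t tu by (auto simp: slice_def)
  have pin: "cp2_of p \<in> slice p T"
    using subspace_0[OF T(1)] p by (force simp: slice_def)
  have "u \<noteq> 0"
    using uv(4) dependent_zero[of "{u, v}"] by auto
  have "slice p T \<noteq> {x}" for x
  proof
    assume "slice p T = {x}"
    then have "cp2_of (p + 0) = cp2_of (p + t *\<^sub>R u)"
      using mem pin by simp
    then have "0 = t *\<^sub>R u"
      using cp2_of_add_eq_iff[OF p, of 0 "t *\<^sub>R u"] T tu t p by auto
    then show False
      using t(1) \<open>u \<noteq> 0\<close> by simp
  qed
  moreover have "slice p T \<noteq> hyp_plane"
  proof
    assume "slice p T = hyp_plane"
    then have "cp2_of (p + t *\<^sub>R z) \<in> slice p T"
      using cp2_of_in_hyp_plane t(4) neg_nonzero by blast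
    then have "t *\<^sub>R z \<in> T"
      using cp2_of_in_slice[OF p T(2) _ t(4)] z(1) by (simp add: herm_linear)
    then have "(1 / t) *\<^sub>R (t *\<^sub>R z) \<in> T"
      by (rule subspace_scale[OF T(1)])
    then show False
      using t(1) z(2) by simp
  qed
  moreover have "\<not> is_geodesic (slice p T)"
  proof
    assume "is_geodesic (slice p T)"
    then obtain W where W: "subspace W" "dim W = 2" "real_valued_on W"
      and eq: "slice p T = hyp_plane \<inter> projectivize W"
      unfolding is_geodesic_def by blast
    obtain c where c: "c \<noteq> 0" "c *s p \<in> W"
      using pin eq cp2_of_in_projectivize neg_nonzero[OF p] by auto
    \<comment> \<open>The scalar that takes \<open>p\<close> into \<open>W\<close> also takes
      \<open>x\<close> there, because the phases agree by \<open>herm_real_ratio\<close>. Applied to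
      \<open>u\<close> and \<open>v\<close>, this puts three independent vectors in the
      two-dimensional \<open>W\<close>.\<close>
    have *: "c *s x \<in> W" if x: "neg (p + t *\<^sub>R x)" "x \<in> T" for x
    proof -
      have "cp2_of (p + t *\<^sub>R x) \<in> slice p T"
        using x subspace_scale[OF T(1)] by (auto simp: slice_def)
      then obtain d where d: "d \<noteq> 0" "d *s (p + t *\<^sub>R x) \<in> W"
        using eq cp2_of_in_projectivize neg_nonzero[OF x(1)] by auto
      have pp: "herm p p \<in> \<real>" "herm p p \<noteq> 0"
        using herm_self_real[of p] p by (metis Reals_of_real) (use p in \<open>auto simp: neg_def\<close>)
      have "herm (c *s p) (d *s (p + t *\<^sub>R x)) \<in> \<real>"
        using W(3) c d by (simp add: real_valued_on_def)
      moreover have "herm p x = 0"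
        using T(2) x(2) herm_eq_0_commute[of p x] by blast
      then have "herm p (p + t *\<^sub>R x) = herm p p"
        by (simp add: herm_linear)
      ultimately have "c = of_real (Re (c * cnj d) / (cmod d)\<^sup>2) * d"
        using herm_real_ratio pp d(1) by metis
      then have "c *s (p + t *\<^sub>R x) = (Re (c * cnj d) / (cmod d)\<^sup>2) *\<^sub>R (d *s (p + t *\<^sub>R x))"
        by (metis scaleR_eq_smult vector_smult_assoc)
      then have "c *s (p + t *\<^sub>R x) \<in> W"
        using subspace_scale[OF W(1) d(2)] by simp
      then have "(1 / t) *\<^sub>R (c *s (p + t *\<^sub>R x) - c *s p) \<in> W"
        using c(2) by (intro subspace_scale subspace_diff W(1))
      also have "(1 / t) *\<^sub>R (c *s (p + t *\<^sub>R x) - c *s p) = c *s x"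
        using t(1) by (simp add: scaleR_eq_smult vector_smult_assoc vector_add_ldistrib)
      finally show ?thesis .
    qed
    have "p \<notin> span {u, v}"
      using herm_span_orthogonal[of "{u, v}" p p] T(2) uv p by (auto simp: neg_def)
    then have ind: "independent {p, u, v}"
      using uv(4) by (rule independent_insertI)
    have lin: "linear ((*s) c :: complex ^ 3 \<Rightarrow> _)"
      by (rule linearI) (simp_all add: scaleR_eq_smult vector_smult_assoc vector_add_ldistrib mult.commute)
    have inj: "inj_on ((*s) c) A" for A :: "(complex ^ 3) set"
      using c(1) by (auto simp: inj_on_def)
    have "(*s) c ` {p, u, v} \<subseteq> W"
      using * t uv c(2) by auto
    then have "card ((*s) c ` {p, u, v}) \<le> dim W"
      using linear_independent_injective_image[OF lin ind inj] by (rule independent_card_le_dim)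
    moreover have "card ((*s) c ` {p, u, v}) = card {p, u, v}"
      using inj by (rule card_image)
    moreover have "p \<noteq> u" "p \<noteq> v"
      using \<open>p \<notin> span {u, v}\<close> by (auto intro: span_base)
    ultimately show False
      using W(2) uv(3) by simp
  qed
  ultimately show ?thesis
    using pin by (auto simp: trivial_set_def)
qed

lemma vec_span_insert_orthogonal:
  assumes "neg p" "herm u p = 0"
  shows "{x \<in> vec.span {p, u}. herm x p = 0} = vec.span {u}"
proof -
  have "x \<in> vec.span {u}" if x: "x \<in> vec.span {p, u}" "herm x p = 0" for x
  proof -
    obtain k l where k: "x - k *s p = l *s u"
      using x(1) by (auto simp: vec.span_breakdown_eq vec.span_singleton)
    then have "herm (x - k *s p) p = 0"
      by (simp add: herm_linear assms)
    then have "k = 0"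
      using x(2) assms(1) by (auto simp: herm_linear neg_def)
    with k show ?thesis
      by (auto simp: vec.span_singleton)
  qed
  moreover have "vec.span {u} \<subseteq> vec.span {p, u}"
    by (intro vec.span_mono) auto
  ultimately show ?thesis
    using assms(2) by (auto simp: vec.span_singleton herm_linear)
qed

text \<open>The directions \<open>u\<close> and \<open>\<i> *s u\<close> are independent over the
  reals, and a direction outside \<open>W\<close> exists because its complex dimension is at most
  2.\<close>

lemma complex_geodesic_nontrivial:
  assumes "is_complex_geodesic C"
  shows "complete_totally_geodesic C \<and> \<not> trivial_set C"
proof -
  obtain p u where p: "neg p" and u: "herm u p = 0" "Re (herm u u) > 0"
    and C: "C = hyp_plane \<inter> projectivize (vec.span {p, u})"
    using assms by (rule complex_geodesicE)
  let ?W = "vec.span {p, u}"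
  have W: "p \<in> ?W" "u \<in> ?W" "vec.subspace ?W"
    by (auto intro: vec.span_base)
  interpret polar_subspace p ?W
    using p W by (intro polar_subspace_complex)
  let ?T = "{v \<in> ?W. herm v p = 0}"
  have "u \<noteq> 0"
    using u(2) by auto
  have iu: "\<i> *s u \<noteq> r *\<^sub>R u" for r
  proof
    assume "\<i> *s u = r *\<^sub>R u"
    then have "\<i> = of_real r"
      using \<open>u \<noteq> 0\<close> by (simp add: scaleR_eq_smult)
    then show False
      by (metis Im_complex_of_real imaginary_unit.simps(2) zero_neq_one)
  qed
  then have "independent {\<i> *s u, u}"
    using \<open>u \<noteq> 0\<close> by (auto simp: independent_insert span_singleton)
  moreover have "\<i> *s u \<noteq> u"
    using iu[of 1] by simp
  moreover have "subspace ?T"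
    using sub by (auto simp: subspace_def herm_linear)
  moreover have "\<i> *s u \<in> ?T" "u \<in> ?T"
    using W u vec.subspace_scale by (auto simp: herm_linear)
  moreover obtain z where "herm z p = 0" "z \<notin> ?W"
  proof -
    have "vec.dim ?W \<le> card {p, u}"
      unfolding vec.dim_span by (intro vec.dim_le_card') auto
    also have "\<dots> \<le> 2"
      by (simp add: card_insert_if)
    finally have "?W \<noteq> UNIV"
      using vec_dim_complex_3 by fastforce
    then obtain y where y: "y \<notin> ?W" by auto
    \<comment> \<open>Projecting \<open>y\<close> orthogonally to \<open>p\<close> changes it by an
      element of \<open>W\<close>, so it stays outside.\<close>
    let ?z = "y - (herm y p / herm p p) *s p"
    have "?z \<notin> ?W"
    proof
      assume "?z \<in> ?W"
      then have "?z + (herm y p / herm p p) *s p \<in> ?W"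
        using W by (intro vec.span_add vec.span_scale)
      with y show False by simp
    qed
    moreover have "herm ?z p = 0"
      using p by (auto simp: herm_linear neg_def)
    ultimately show thesis using that by blast
  qed
  ultimately have "\<not> trivial_set (slice p ?T)"
    using p by (intro not_trivial_slice[of p ?T "\<i> *s u" u z]) auto
  then show ?thesis
    using complete_totally_geodesic_complex[OF p W(1,3)] hyp_plane_projectivize_eq_slice C by simp
qed

text \<open>The directions \<open>u\<close> and \<open>v\<close> are independent, while
  \<open>\<i> *s u\<close> lies outside \<open>W\<close> because its product with \<open>u\<close>
  is not real.\<close>

lemma real_plane_nontrivial:
  assumes "is_real_plane C"
  shows "complete_totally_geodesic C \<and> \<not> trivial_set C"
proof -
  obtain p u v where p: "neg p" and uv: "herm u p = 0" "herm v p = 0" "herm u v = 0" "u \<noteq> v"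
    "Re (herm u u) > 0" "Re (herm v v) > 0" and real: "real_valued_on (span {p, u, v})"
    and C: "C = hyp_plane \<inter> projectivize (span {p, u, v})"
    using assms by (rule real_planeE)
  let ?W = "span {p, u, v}"
  have W: "p \<in> ?W" "u \<in> ?W" "v \<in> ?W"
    by (auto intro: span_base)
  interpret polar_subspace p ?W
    using p W real by (intro polar_subspace_real) auto
  let ?T = "{v \<in> ?W. herm v p = 0}"
  have "pairwise (\<lambda>x y. herm x y = 0) {u, v}"
    using uv herm_eq_0_commute[of u v] by (auto simp: pairwise_def)
  then have "independent {u, v}"
    by (rule herm_orthogonal_independent(2)) (use uv in auto)
  moreover have "subspace ?T"
    using sub by (auto simp: subspace_def herm_linear)
  moreover have "\<i> *s u \<notin> ?W"
  proof
    assume "\<i> *s u \<in> ?W"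
    then have "herm (\<i> *s u) u \<in> \<real>"
      using real W by (simp add: real_valued_on_def)
    then show False
      using uv by (simp add: herm_linear complex_is_Real_iff)
  qed
  ultimately have "\<not> trivial_set (slice p ?T)"
    using p uv W by (intro not_trivial_slice[of p ?T u v "\<i> *s u"]) (auto simp: herm_linear)
  then show ?thesis
    using complete_totally_geodesic_real[OF p W(1) sub real] hyp_plane_projectivize_eq_slice C
    by simp
qed

section \<open>Directions of a complete totally geodesic set at a point\<close>

text \<open>Normalising the base point gives \<open>herm (p + u) (p + v) = herm u v - 1\<close> for
  \<open>u\<close> and \<open>v\<close> orthogonal to \<open>p\<close>.\<close>

locale complete_totally_geodesic_at =
  fixes C :: "cp2 set" and p :: "complex ^ 3"
  assumes ctg: "complete_totally_geodesic C" and unit: "herm p p = -1" and p_in: "cp2_of p \<in> C"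
begin

text \<open>This is the cone of \<open>C\<close> in the chart. Quantifying over all \<open>t\<close>
  makes it invariant under real scaling, and admits vectors too long for \<open>p + v\<close> to be
  negative.\<close>

definition directions :: "(complex ^ 3) set" where
  "directions = {v. herm v p = 0 \<and> (\<forall>t::real. neg (p + t *\<^sub>R v) \<longrightarrow> cp2_of (p + t *\<^sub>R v) \<in> C)}"

lemma neg_p: "neg p"
  using unit by (simp add: neg_def)

lemma sub_hyp_plane: "C \<subseteq> hyp_plane"
  using ctg by (simp add: complete_totally_geodesic_def)

lemma geodesic_subset:
  assumes "neg a" "neg b" "herm a b \<in> \<real>" "cp2_of a \<noteq> cp2_of b" "cp2_of a \<in> C" "cp2_of b \<in> C"
    and x: "x \<in> span {a, b}" "neg x"
  shows "cp2_of x \<in> C"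
proof -
  let ?G = "hyp_plane \<inter> projectivize (span {a, b})"
  have mem: "cp2_of y \<in> ?G" if "y \<in> span {a, b}" "neg y" for y
    using that cp2_of_in_hyp_plane[of y] neg_nonzero[of y] by (auto simp: projectivize_def)
  have "is_geodesic ?G"
    using assms by (intro geodesicI)
  moreover have "cp2_of a \<in> ?G" "cp2_of b \<in> ?G"
    using assms by (intro mem span_base; simp)+
  ultimately have "?G \<subseteq> C"
    using ctg assms unfolding complete_totally_geodesic_def by blast
  then show ?thesis
    using mem[OF x] by blast
qed

lemma directions_orthogonal:
  assumes "v \<in> directions"
  shows "herm v p = 0" "herm p v = 0"
  using assms herm_eq_0_commute[of p v] by (auto simp: directions_def)

lemma directions_in:
  assumes "v \<in> directions" "neg (p + v)"
  shows "cp2_of (p + v) \<in> C"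
proof -
  have "neg (p + 1 *\<^sub>R v) \<longrightarrow> cp2_of (p + 1 *\<^sub>R v) \<in> C"
    using assms(1) unfolding directions_def by blast
  then show ?thesis
    using assms(2) by simp
qed

text \<open>One parameter suffices: the real line through \<open>p\<close> in direction
  \<open>v\<close> lies in the span of \<open>p\<close> and \<open>p + s *\<^sub>R v\<close>, whose
  product is real, so it follows a single geodesic.\<close>

lemma directionsI:
  assumes v: "herm v p = 0" and s: "s \<noteq> 0" and q: "neg (p + s *\<^sub>R v)" "cp2_of (p + s *\<^sub>R v) \<in> C"
  shows "v \<in> directions"
proof (cases "v = 0")
  case True
  then show ?thesis
    using p_in by (simp add: directions_def)
next
  case False
  let ?q = "p + s *\<^sub>R v"
  have pv: "herm p v = 0"
    using v by (simp add: herm_eq_0_commute)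
  have "cp2_of (p + 0) \<noteq> cp2_of ?q"
    using cp2_of_add_eq_iff[OF neg_p, of 0 "s *\<^sub>R v"] v False s q(1) neg_p
    by (simp add: herm_linear)
  moreover have "herm p ?q \<in> \<real>"
    by (simp add: herm_linear pv unit)
  moreover have "p + t *\<^sub>R v \<in> span {p, ?q}" for t
  proof -
    have "p + (t / s) *\<^sub>R (?q - p) \<in> span {p, ?q}"
      by (intro span_add span_scale span_diff span_base) auto
    then show ?thesis
      using s by simp
  qed
  ultimately show ?thesis
    unfolding directions_def using v geodesic_subset[of p ?q] neg_p q p_in by auto
qed

lemma directions_scaleR:
  assumes "v \<in> directions"
  shows "r *\<^sub>R v \<in> directions"
  using assms unfolding directions_def by (simp add: herm_linear)

lemma directions_scaleR_iff:
  assumes "r \<noteq> 0"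
  shows "r *\<^sub>R v \<in> directions \<longleftrightarrow> v \<in> directions"
  using assms directions_scaleR[of "r *\<^sub>R v" "1 / r"] directions_scaleR[of v r] by auto

text \<open>For each \<open>t\<close> the defining implication excludes the open set of negative
  lifts of points outside \<open>C\<close>; thus \<open>directions\<close> is an intersection of
  closed preimages.\<close>

lemma closed_directions: "closed directions"
proof -
  let ?O = "{x. neg x \<and> cp2_of x \<notin> C}"
  have "open ?O"
    using ctg closedin_hyp_plane_iff[OF sub_hyp_plane]
    unfolding complete_totally_geodesic_def by blast
  then have "closed (- ?O)"
    by (rule closed_Compl)
  then have "closed ((\<lambda>v. p + t *\<^sub>R v) -` (- ?O))" for t
    by (rule closed_vimage) (intro continuous_intros)
  moreover have "closed {v. herm v p = 0}"
    by (intro closed_Collect_eq continuous_intros)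
  ultimately have "closed ({v. herm v p = 0} \<inter> (\<Inter>t::real. (\<lambda>v. p + t *\<^sub>R v) -` (- ?O)))"
    by (intro closed_Int closed_INT) auto
  also have "{v. herm v p = 0} \<inter> (\<Inter>t::real. (\<lambda>v. p + t *\<^sub>R v) -` (- ?O)) = directions"
    by (auto simp: directions_def)
  finally show ?thesis .
qed

text \<open>The vectors \<open>p + u\<close> and \<open>k (p + v)\<close> have a negative real product, so \<open>p + u + t k (p + v)\<close>
  runs through points of the geodesic joining \<open>[p + u]\<close> and \<open>[p + v]\<close>; up to a positive factor the
  vector below is the affine coordinate of that point.\<close>

lemma directions_join:
  fixes t :: real
  assumes u: "u \<in> directions" "neg (p + u)" and v: "v \<in> directions" "neg (p + v)" and "t \<ge> 0"
  defines "k \<equiv> 1 - herm u v"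
  shows "(1 + of_real t * cnj k) *s (u + (of_real t * k) *s v) \<in> directions"
proof (cases "u = v")
  \<comment> \<open>Coinciding points determine no geodesic, but \<open>k\<close> is then real and
    the vector is a real multiple of \<open>u\<close>.\<close>
  case True
  define \<kappa> where "\<kappa> = 1 - Re (herm u u)"
  have "k = of_real \<kappa>"
    using herm_self_real[of u] by (simp add: k_def \<kappa>_def True)
  then have "(1 + of_real t * cnj k) *s (u + (of_real t * k) *s v) = ((1 + t * \<kappa>) * (1 + t * \<kappa>)) *\<^sub>R u"
    unfolding True scaleR_eq_smult by (simp add: vec_eq_iff algebra_simps)
  then show ?thesis
    using directions_scaleR[OF u(1)] True by simp
next
  case False
  define a where "a = p + u"
  define b where "b = k *s (p + v)"
  have orth: "herm u p = 0" "herm p v = 0" "herm v p = 0"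
    using u v directions_orthogonal by auto
  then have h: "herm a (p + v) = - k"
    by (simp add: a_def k_def herm_linear unit)
  have k: "k \<noteq> 0"
    using h herm_neg_nonzero[OF u(2) v(2)] by (auto simp: a_def)
  have b: "neg b" "cp2_of b = cp2_of (p + v)"
    unfolding b_def using neg_smult[OF k] v(2) cp2_of_smult[OF neg_nonzero k] by blast+
  have "herm a b = - (k * cnj k)"
    unfolding b_def herm_smult_right h by (simp add: mult.commute)
  then have ab: "herm a b = of_real (- (cmod k)\<^sup>2)"
    by (simp only: of_real_minus complex_norm_square)
  define x where "x = a + t *\<^sub>R b"
  define m where "m = 1 + of_real t * k"
  \<comment> \<open>The chart coordinate has the factor \<open>1 / m\<close>. Using
    \<open>cnj m\<close> instead avoids division and differs by the positive real
    \<open>(cmod m)\<^sup>2\<close>.\<close>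
  define w where "w = cnj m *s (u + (of_real t * k) *s v)"
  have a: "neg a"
    using u(2) by (simp add: a_def)
  have "Re (herm a b) \<le> 0"
    by (simp add: ab)
  then have x: "neg x"
    using a b(1) \<open>t \<ge> 0\<close> unfolding x_def by (intro neg_add_scaleR)
  have "cp2_of a \<noteq> cp2_of b"
    using cp2_of_add_eq_iff[OF neg_p, of u v] u v orth False by (simp add: a_def b(2))
  moreover have "x \<in> span {a, b}"
    unfolding x_def by (intro span_add span_scale span_base) auto
  moreover have "herm a b \<in> \<real>"
    unfolding ab by (rule Reals_of_real)
  moreover have "cp2_of a \<in> C" "cp2_of b \<in> C"
    using directions_in[OF u] directions_in[OF v] by (simp_all add: a_def b(2))
  ultimately have xC: "cp2_of x \<in> C"
    using geodesic_subset[OF a b(1)] x by blast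
  have x_eq: "x = m *s p + (u + (of_real t * k) *s v)"
    by (simp add: x_def a_def b_def m_def vec_eq_iff algebra_simps scaleR_eq_smult)
  have "herm x p = - m"
    by (simp add: x_eq herm_linear orth unit)
  then have m: "m \<noteq> 0"
    using herm_neg_nonzero[OF x neg_p] by auto
  have "of_real (1 / (cmod m)\<^sup>2) * cnj m = 1 / m"
    unfolding of_real_divide complex_norm_square using m by simp
  then have "(1 / (cmod m)\<^sup>2) *\<^sub>R w = (1 / m) *s (u + (of_real t * k) *s v)"
    unfolding w_def scaleR_eq_smult vector_smult_assoc by (rule arg_cong)
  then have eq: "p + (1 / (cmod m)\<^sup>2) *\<^sub>R w = (1 / m) *s x"
    using m by (simp add: x_eq vector_add_ldistrib vector_smult_assoc)
  have "w \<in> directions"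
  proof (rule directionsI)
    show "herm w p = 0"
      by (simp add: w_def herm_linear orth)
    show "1 / (cmod m)\<^sup>2 \<noteq> 0"
      using m by simp
    show "neg (p + (1 / (cmod m)\<^sup>2) *\<^sub>R w)" "cp2_of (p + (1 / (cmod m)\<^sup>2) *\<^sub>R w) \<in> C"
      unfolding eq using x xC m neg_smult cp2_of_smult neg_nonzero by auto
  qed
  then show ?thesis
    by (simp add: w_def m_def)
qed

text \<open>Near \<open>p\<close> the form \<open>herm u v\<close> is negligible, so \<open>k\<close> tends to \<open>1\<close> and the midpoints of
  \<open>directions_join\<close> tend to twice the sum.\<close>

lemma directions_add:
  assumes "u \<in> directions" "v \<in> directions"
  shows "u + v \<in> directions"
proof -
  define k where "k \<epsilon> = 1 - of_real (\<epsilon>\<^sup>2) * herm u v" for \<epsilon> :: real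
  \<comment> \<open>The join of the vectors scaled by \<open>\<epsilon>\<close>, at
    \<open>t = 1\<close>, divided by \<open>\<epsilon>\<close>. The quotient extends continuously to
    0.\<close>
  define f where "f \<epsilon> = (1 + cnj (k \<epsilon>)) *s (u + k \<epsilon> *s v)" for \<epsilon>
  have "continuous_on UNIV f"
    unfolding f_def k_def by (intro continuous_intros)
  then have "isCont f 0"
    by (simp add: continuous_on_eq_continuous_at)
  then have lim: "(f \<longlongrightarrow> f 0) (at_right 0)"
    unfolding isCont_def filterlim_at_split by blast
  have "\<forall>\<^sub>F \<epsilon> in at_right (0::real). 0 < \<epsilon> \<and> neg (p + \<epsilon> *\<^sub>R u) \<and> neg (p + \<epsilon> *\<^sub>R v)"
    by (intro eventually_conj eventually_neg_add_scaleR neg_p eventually_at_right_less)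
  then have "\<forall>\<^sub>F \<epsilon> in at_right 0. f \<epsilon> \<in> directions"
  proof (rule eventually_mono)
    fix \<epsilon> :: real assume e: "0 < \<epsilon> \<and> neg (p + \<epsilon> *\<^sub>R u) \<and> neg (p + \<epsilon> *\<^sub>R v)"
    have "(1 + of_real 1 * cnj (1 - herm (\<epsilon> *\<^sub>R u) (\<epsilon> *\<^sub>R v))) *s
        (\<epsilon> *\<^sub>R u + (of_real 1 * (1 - herm (\<epsilon> *\<^sub>R u) (\<epsilon> *\<^sub>R v))) *s (\<epsilon> *\<^sub>R v)) \<in> directions"
      using e assms by (intro directions_join directions_scaleR) auto
    also have "1 - herm (\<epsilon> *\<^sub>R u) (\<epsilon> *\<^sub>R v) = k \<epsilon>"
      by (simp add: k_def herm_linear power2_eq_square)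
    also have "(1 + of_real 1 * cnj (k \<epsilon>)) *s (\<epsilon> *\<^sub>R u + (of_real 1 * k \<epsilon>) *s (\<epsilon> *\<^sub>R v)) = \<epsilon> *\<^sub>R f \<epsilon>"
      unfolding f_def scaleR_eq_smult by (simp add: vec_eq_iff algebra_simps)
    finally show "f \<epsilon> \<in> directions"
      using e by (simp add: directions_scaleR_iff)
  qed
  then have "f 0 \<in> directions"
    using Lim_in_closed_set[OF closed_directions _ _ lim] by simp
  also have "f 0 = 2 *\<^sub>R (u + v)"
    by (simp add: f_def k_def scaleR_eq_smult)
  finally show ?thesis
    by (simp add: directions_scaleR_iff)
qed

lemma subspace_directions: "subspace directions"
  unfolding subspace_def using directions_add directions_scaleR p_in
  by (auto simp: directions_def)

text \<open>The join at \<open>t = 1\<close> has coefficients \<open>1 + cnj k\<close> and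
  \<open>k + (cmod k)\<^sup>2\<close>. Subtracting their real parts, allowed in a real subspace,
  leaves \<open>Im k\<close> times the claimed vector.\<close>

lemma directions_i_diff:
  assumes u: "u \<in> directions" "neg (p + u)" and v: "v \<in> directions" "neg (p + v)"
    and im: "Im (herm u v) \<noteq> 0"
  shows "\<i> *s (v - u) \<in> directions"
proof -
  define k where "k = 1 - herm u v"
  have "(1 + of_real 1 * cnj k) *s (u + (of_real 1 * k) *s v) \<in> directions"
    unfolding k_def by (intro directions_join assms) simp
  then have "(1 + of_real 1 * cnj k) *s (u + (of_real 1 * k) *s v)
      - (1 + Re k) *\<^sub>R u - (Re k + (cmod k)\<^sup>2) *\<^sub>R v \<in> directions"
    by (intro subspace_diff subspace_scale subspace_directions u v)
  also have "(1 + of_real 1 * cnj k) *s (u + (of_real 1 * k) *s v)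
      - (1 + Re k) *\<^sub>R u - (Re k + (cmod k)\<^sup>2) *\<^sub>R v = Im k *\<^sub>R (\<i> *s (v - u))"
    unfolding scaleR_eq_smult of_real_add complex_norm_square
    by (auto simp: vec_eq_iff complex_eq_iff algebra_simps)
  finally have "Im k *\<^sub>R (\<i> *s (v - u)) \<in> directions" .
  moreover have "Im k \<noteq> 0"
    using im by (simp add: k_def)
  ultimately show ?thesis
    using directions_scaleR_iff by blast
qed

text \<open>Subtracting the results of \<open>directions_i_diff\<close> for \<open>u\<close> and for
  half of \<open>u\<close> eliminates \<open>v\<close>. Scaling all vectors by a small
  \<open>\<epsilon>\<close> makes them admissible and keeps the imaginary parts nonzero.\<close>

lemma directions_i:
  assumes "u \<in> directions" "v \<in> directions" "Im (herm u v) \<noteq> 0"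
  shows "\<i> *s u \<in> directions"
proof -
  have "\<forall>\<^sub>F \<epsilon> in at_right (0::real). 0 < \<epsilon> \<and> neg (p + \<epsilon> *\<^sub>R u) \<and> neg (p + \<epsilon> *\<^sub>R v)
      \<and> neg (p + \<epsilon> *\<^sub>R ((1/2) *\<^sub>R u))"
    by (intro eventually_conj eventually_neg_add_scaleR neg_p eventually_at_right_less)
  then obtain \<epsilon> :: real where e: "0 < \<epsilon>" "neg (p + \<epsilon> *\<^sub>R u)" "neg (p + \<epsilon> *\<^sub>R v)"
      "neg (p + \<epsilon> *\<^sub>R ((1/2) *\<^sub>R u))"
    using eventually_happens[of _ "at_right (0::real)"] by (auto simp: trivial_limit_at_right_real)
  have "\<i> *s (\<epsilon> *\<^sub>R v - \<epsilon> *\<^sub>R ((1/2) *\<^sub>R u)) - \<i> *s (\<epsilon> *\<^sub>R v - \<epsilon> *\<^sub>R u) \<in> directions"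
    by (intro subspace_diff subspace_directions directions_i_diff directions_scaleR assms e)
      (use e assms in \<open>simp_all add: herm_linear\<close>)
  also have "\<i> *s (\<epsilon> *\<^sub>R v - \<epsilon> *\<^sub>R ((1/2) *\<^sub>R u)) - \<i> *s (\<epsilon> *\<^sub>R v - \<epsilon> *\<^sub>R u) = (\<epsilon> / 2) *\<^sub>R (\<i> *s u)"
    unfolding scaleR_eq_smult by (simp add: vec_eq_iff algebra_simps)
  finally show ?thesis
    using e(1) by (simp add: directions_scaleR_iff)
qed

text \<open>Every point of \<open>C\<close> has a chart coordinate, which is a direction by
  \<open>directionsI\<close>. Classifying \<open>C\<close> thus becomes linear algebra on
  \<open>directions\<close>.\<close>

lemma eq_slice: "C = slice p directions"
proof (intro equalityI subsetI)
  fix x assume x: "x \<in> C"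
  then obtain y where y: "neg y" "x = cp2_of y"
    using sub_hyp_plane hyp_planeE by blast
  then obtain v where v: "herm v p = 0" "cp2_of (p + v) = x" "neg (p + v)"
    using hyp_planeE_add[OF neg_p] by metis
  then have "v \<in> directions"
    using x directionsI[of v 1] by simp
  with v show "x \<in> slice p directions"
    by (auto simp: slice_def)
qed (auto simp: slice_def directions_in)

end

text \<open>Otherwise four nonzero, pairwise orthogonal, non-isotropic vectors would be independent
  in complex dimension 3.\<close>

lemma orthogonal_frame:
  assumes "neg p" "herm u p = 0" "herm v p = 0" "herm w p = 0" "herm u v = 0" "herm w u = 0"
    "herm w v = 0" "u \<noteq> 0" "v \<noteq> 0"
  shows "w = 0"
proof (rule ccontr)
  assume "w \<noteq> 0"
  have pos: "Re (herm u u) > 0" "Re (herm v v) > 0" "Re (herm w w) > 0"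
    using herm_pos_of_orthogonal_neg assms \<open>w \<noteq> 0\<close> by auto
  have p: "Re (herm p p) < 0"
    using assms(1) by (simp add: neg_def)
  have sym: "herm p u = 0" "herm p v = 0" "herm p w = 0" "herm v u = 0" "herm u w = 0" "herm v w = 0"
    using assms by (simp_all add: herm_eq_0_commute)
  have "pairwise (\<lambda>x y. herm x y = 0) {p, u, v, w}"
    using assms sym by (auto simp: pairwise_def)
  then have "vec.independent {p, u, v, w}"
    by (rule herm_orthogonal_independent(1)) (use pos p in auto)
  then have "card {p, u, v, w} \<le> vec.dim (UNIV :: (complex ^ 3) set)"
    by (intro vec.independent_card_le_dim) auto
  moreover have "p \<noteq> u" "p \<noteq> v" "p \<noteq> w" "u \<noteq> v" "u \<noteq> w" "v \<noteq> w"
    using pos p assms sym by auto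
  then have "card {p, u, v, w} = 4"
    by simp
  ultimately show False
    unfolding vec_dim_complex_3 by simp
qed

section \<open>Classification of the spaces of directions\<close>

context complete_totally_geodesic_at
begin

text \<open>Gram-Schmidt with real coefficients works inside \<open>directions\<close>. Real
  dimensions 0, 1 and 2 give a point, a geodesic and a real plane; \<open>orthogonal_frame\<close>
  rules out more.\<close>

lemma real_cases:
  assumes real: "\<And>u v. u \<in> directions \<Longrightarrow> v \<in> directions \<Longrightarrow> herm u v \<in> \<real>"
  shows "trivial_set C \<or> is_real_plane C"
proof -
  have C: "C = hyp_plane \<inter> projectivize (span (insert p B))"
    if B: "directions = span B" for B
  proof -
    have orth: "\<forall>x\<in>B. herm x p = 0"
      using B directions_orthogonal by (auto intro: span_base)
    then have "\<forall>x\<in>B. herm p x = 0"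
      using herm_eq_0_commute by blast
    have "herm x y \<in> \<real>" if "x \<in> B" "y \<in> B" for x y
      using that B real by (auto intro: span_base)
    then have "real_valued_on (insert p B)"
      using orth \<open>\<forall>x\<in>B. herm p x = 0\<close> by (auto simp: real_valued_on_def unit)
    then interpret polar_subspace p "span (insert p B)"
      by (intro polar_subspace_real real_valued_on_span neg_p) (auto intro: span_base)
    show ?thesis
      unfolding hyp_plane_projectivize_eq_slice span_insert_orthogonal[OF neg_p orth] B[symmetric]
      by (rule eq_slice)
  qed
  show ?thesis
  proof (cases "directions \<subseteq> {0}")
    case True
    then have "directions = {0}"
      using subspace_0[OF subspace_directions] by blast
    then have "slice p directions = {cp2_of p}"
      using neg_p by (auto simp: slice_def)
    then have "C = {cp2_of p}"
      by (rule eq_slice[THEN trans])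
    then show ?thesis
      using sub_hyp_plane by (auto simp: trivial_set_def)
  next
    case False
    then obtain u where u: "u \<in> directions" "u \<noteq> 0" by blast
    note up = directions_orthogonal[OF u(1)]
    show ?thesis
    proof (cases "directions \<subseteq> span {u}")
      case True
      then have "directions = span {u}"
        using u(1) subspace_directions by (simp add: span_minimal subset_antisym)
      then show ?thesis
        using C geodesic_orthogonalI[OF neg_p up(1) u(2)] by (simp add: trivial_set_def)
    next
      case False
      then obtain v0 where v0: "v0 \<in> directions" "v0 \<notin> span {u}" by blast
      have proj: "x - (Re (herm x y) / Re (herm y y)) *\<^sub>R y \<in> directions"
          "herm (x - (Re (herm x y) / Re (herm y y)) *\<^sub>R y) y = 0"
        if "x \<in> directions" "y \<in> directions" "y \<noteq> 0" for x y
      proof -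
        have "Re (herm y y) \<noteq> 0"
          using herm_pos_of_orthogonal_neg[OF neg_p] that directions_orthogonal by force
        then show "herm (x - (Re (herm x y) / Re (herm y y)) *\<^sub>R y) y = 0"
          using real that by (intro herm_diff_proj)
      qed (intro subspace_diff subspace_scale subspace_directions that)
      define v where "v = v0 - (Re (herm v0 u) / Re (herm u u)) *\<^sub>R u"
      have v: "v \<in> directions" "herm v u = 0"
        unfolding v_def using proj v0(1) u by auto
      have "v \<noteq> 0"
        using v0(2) by (auto simp: v_def span_singleton)
      have uv: "herm u v = 0"
        using v(2) by (simp add: herm_eq_0_commute)
      note vp = directions_orthogonal[OF v(1)]
      have "w \<in> span {u, v}" if "w \<in> directions" for w
      proof -
        \<comment> \<open>After both projections the remainder \<open>w2\<close> is orthogonal to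
          \<open>p\<close>, \<open>u\<close> and \<open>v\<close>, hence zero.\<close>
        define w1 where "w1 = w - (Re (herm w u) / Re (herm u u)) *\<^sub>R u"
        define w2 where "w2 = w1 - (Re (herm w1 v) / Re (herm v v)) *\<^sub>R v"
        have w1: "w1 \<in> directions" "herm w1 u = 0"
          unfolding w1_def using proj that u by auto
        have w2: "w2 \<in> directions" "herm w2 v = 0"
          unfolding w2_def using proj w1 v(1) \<open>v \<noteq> 0\<close> by auto
        have "herm w2 u = 0"
          using w1 v by (simp add: w2_def herm_linear)
        then have "w2 = 0"
          using orthogonal_frame[OF neg_p up(1) vp(1)] directions_orthogonal[OF w2(1)] uv w2(2) u(2)
            \<open>v \<noteq> 0\<close> by blast
        then have "w = (Re (herm w u) / Re (herm u u)) *\<^sub>R u + (Re (herm w1 v) / Re (herm v v)) *\<^sub>R v"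
          by (simp add: w2_def w1_def)
        also have "\<dots> \<in> span {u, v}"
          by (intro span_add span_scale span_base) auto
        finally show ?thesis .
      qed
      moreover have "span {u, v} \<subseteq> directions"
        using u(1) v(1) subspace_directions by (intro span_minimal) auto
      ultimately have "directions = span {u, v}"
        by blast
      then show ?thesis
        using C real_planeI[OF neg_p up(1) vp(1) uv u(2) \<open>v \<noteq> 0\<close>] by simp
    qed
  qed
qed

lemma directions_smult:
  assumes "u \<in> directions" "\<i> *s u \<in> directions"
  shows "c *s u \<in> directions"
proof -
  have "c *s u = Re c *\<^sub>R u + Im c *\<^sub>R (\<i> *s u)"
    by (subst complex_eq[of c]) (simp add: scaleR_eq_smult vec_eq_iff algebra_simps)
  then show ?thesis
    using assms directions_add directions_scaleR by simp
qed

text \<open>The whole complex line of \<open>u\<close> lies in \<open>directions\<close>. Either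
  nothing else does, or an orthogonal \<open>w\<close> contributes a second complex line and the two
  fill the complement of \<open>p\<close>.\<close>

lemma complex_cases:
  assumes u: "u \<in> directions" and v: "v \<in> directions" and im: "Im (herm u v) \<noteq> 0"
  shows "is_complex_geodesic C \<or> C = hyp_plane"
proof -
  have u_line: "c *s u \<in> directions" for c
    using directions_smult u directions_i[OF u v im] by blast
  have "u \<noteq> 0"
    using im by auto
  note up = directions_orthogonal[OF u]
  have uu: "Re (herm u u) > 0" "herm u u \<noteq> 0"
    using herm_pos_of_orthogonal_neg[OF neg_p up(1) \<open>u \<noteq> 0\<close>] by auto
  show ?thesis
  proof (cases "directions \<subseteq> vec.span {u}")
    case True
    then have dir: "directions = vec.span {u}"
      using u_line by (auto simp: vec.span_singleton)
    interpret polar_subspace p "vec.span {p, u}"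
      by (intro polar_subspace_complex neg_p vec.span_base) auto
    have "C = hyp_plane \<inter> projectivize (vec.span {p, u})"
      unfolding hyp_plane_projectivize_eq_slice vec_span_insert_orthogonal[OF neg_p up(1)] dir[symmetric]
      by (rule eq_slice)
    then show ?thesis
      using complex_geodesicI[OF neg_p up(1) \<open>u \<noteq> 0\<close>] by simp
  next
    case False
    then obtain w0 where w0: "w0 \<in> directions" "w0 \<notin> vec.span {u}" by blast
    define w where "w = w0 - (herm w0 u / herm u u) *s u"
    have w: "w \<in> directions"
      unfolding w_def by (intro subspace_diff subspace_directions w0 u_line)
    have "w \<noteq> 0"
      using w0(2) by (auto simp: w_def vec.span_singleton)
    have wu: "herm w u = 0"
      using uu by (simp add: w_def herm_linear)
    then have uw: "herm u w = 0"
      by (simp add: herm_eq_0_commute)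
    note wp = directions_orthogonal[OF w]
    have ww: "herm w w \<noteq> 0"
      using herm_pos_of_orthogonal_neg[OF neg_p wp(1) \<open>w \<noteq> 0\<close>] by auto
    \<comment> \<open>Since \<open>w\<close> is orthogonal to the line of \<open>u\<close>,
      \<open>directions_i\<close> does not apply to \<open>w\<close> against that line. It does
      apply to \<open>u + w\<close> against \<open>\<i> *s u\<close>, and subtracting
      \<open>\<i> *s u\<close> leaves \<open>\<i> *s w\<close>.\<close>
    have "u + w \<in> directions"
      using u w by (rule directions_add)
    moreover have "Im (herm (u + w) (\<i> *s u)) \<noteq> 0"
      using uu by (simp add: herm_linear wu)
    ultimately have "\<i> *s (u + w) \<in> directions"
      using directions_i u_line by blast
    then have "\<i> *s (u + w) - \<i> *s u \<in> directions"
      by (intro subspace_diff subspace_directions u_line)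
    then have w_line: "c *s w \<in> directions" for c
      using directions_smult[OF w] by (simp add: vector_add_ldistrib)
    have "x \<in> directions" if x: "herm x p = 0" for x
    proof -
      define y where "y = x - (herm x u / herm u u) *s u - (herm x w / herm w w) *s w"
      have "herm y p = 0" "herm y u = 0" "herm y w = 0"
        using x up wp wu uw uu ww by (simp_all add: y_def herm_linear)
      then have "y = 0"
        using orthogonal_frame[OF neg_p up(1) wp(1) _ uw] \<open>u \<noteq> 0\<close> \<open>w \<noteq> 0\<close> by blast
      then have "x = (herm x u / herm u u) *s u + (herm x w / herm w w) *s w"
        by (simp add: y_def algebra_simps)
      then show ?thesis
        using directions_add[OF u_line w_line] by metis
    qed
    then have dir: "directions = {v \<in> UNIV. herm v p = 0}"
      using directions_orthogonal by blast
    interpret polar_subspace p UNIV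
      by (intro polar_subspace_complex neg_p) auto
    have "C = hyp_plane \<inter> projectivize UNIV"
      unfolding hyp_plane_projectivize_eq_slice dir[symmetric] by (rule eq_slice)
    moreover have "hyp_plane \<subseteq> projectivize UNIV"
      by (auto simp: projectivize_def elim!: hyp_planeE dest: neg_nonzero)
    ultimately show ?thesis
      by blast
  qed
qed

end

text \<open>At any base point, the form is either real on all directions or has a nonreal value
  there; these are the two classified cases.\<close>

lemma complete_totally_geodesic_cases:
  assumes "complete_totally_geodesic C"
  shows "trivial_set C \<or> is_complex_geodesic C \<or> is_real_plane C"
proof (cases "C = {}")
  case True
  then show ?thesis by (simp add: trivial_set_def)
next
  case False
  then obtain x where "x \<in> C" by blast
  moreover from this have "x \<in> hyp_plane"
    using assms by (auto simp: complete_totally_geodesic_def)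
  then obtain p where "herm p p = -1" "x = cp2_of p"
    by (rule hyp_planeE_unit)
  ultimately interpret complete_totally_geodesic_at C p
    using assms by unfold_locales simp_all
  show ?thesis
  proof (cases "\<forall>u\<in>directions. \<forall>v\<in>directions. herm u v \<in> \<real>")
    case True
    then have "trivial_set C \<or> is_real_plane C"
      by (intro real_cases) simp
    then show ?thesis by blast
  next
    case False
    then obtain u v where "u \<in> directions" "v \<in> directions" "Im (herm u v) \<noteq> 0"
      by (auto simp: complex_is_Real_iff)
    then have "is_complex_geodesic C \<or> C = hyp_plane"
      by (rule complex_cases)
    then show ?thesis
      unfolding trivial_set_def by blast
  qed
qed

theorem theorem12:
  "(\<forall>C. complete_totally_geodesic C \<and> \<not> trivial_set C \<longleftrightarrow>
        is_complex_geodesic C \<or> is_real_plane C) \<and>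
   (\<forall>C. complete_totally_geodesic C \<longrightarrow>
        C = {} \<or> (\<exists>x\<in>hyp_plane. C = {x}) \<or> is_geodesic C \<or>
        is_complex_geodesic C \<or> is_real_plane C \<or> C = hyp_plane)"
proof (intro conjI allI impI)
  fix C
  show "complete_totally_geodesic C \<and> \<not> trivial_set C \<longleftrightarrow>
      is_complex_geodesic C \<or> is_real_plane C"
    using complete_totally_geodesic_cases[of C] complex_geodesic_nontrivial[of C]
      real_plane_nontrivial[of C] by argo
next
  fix C
  assume "complete_totally_geodesic C"
  then show "C = {} \<or> (\<exists>x\<in>hyp_plane. C = {x}) \<or> is_geodesic C \<or>
      is_complex_geodesic C \<or> is_real_plane C \<or> C = hyp_plane"
    using complete_totally_geodesic_cases[of C] unfolding trivial_set_def by argo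
qed

end
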